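(* Let $n\ge 2$, let $(G,f)$ be a finite $n$-ary group, and let $\Lambda_1,\ldots,\Lambda_k$ be all the non-equivalent irreducible representations of $(G,f)$ (one from each equivalence class), with degrees $d_1,d_2,\ldots,d_k$. Then $(n-1)|G|$ is divisible by every $d_i$, and $$\sum_{i=1}^k d_i^2=(n-1)|G|.$$
   Context: Notation: $x_i^j$ denotes the sequence $x_i,x_{i+1},\ldots,x_j$ (empty if $j<i$). An $n$-ary group $(G,f)$ ($n\ge 2$), also called a polyadic group, is a non-empty set $G$ with an operation $f:G^n\to G$ that is associative, i.e. $f(x_1^{i-1},f(x_i^{n+i-1}),x_{n+i}^{2n-1})=f(x_1^{j-1},f(x_j^{n+j-1}),x_{n+j}^{2n-1})$ for all $1\le i,j\le n$ and $x_1,\ldots,x_{2n-1}\in G$, and such that for all $x_0,x_1,\ldots,x_n\in G$ and each $i\in\{1,\ldots,n\}$ there is a unique $z\in G$ with $f(x_1^{i-1},z,x_{i+1}^n)=x_0$. A representation of $(G,f)$ of degree $m\ge 1$ is a map $\Lambda:G\to GL_m(\mathbb{C})$ with $\Lambda(f(x_1^n))=\Lambda(x_1)\Lambda(x_2)\cdots\Lambda(x_n)$ for all $x_1,\ldots,x_n\in G$. It is irreducible if no subspace of $\mathbb{C}^m$ other than $0$ and $\mathbb{C}^m$ is invariant under all $\Lambda(x)$, $x\in G$. Two representations $\Lambda,\Lambda'$ of degree $m$ are equivalent if there is $T\in GL_m(\mathbb{C})$ with $\Lambda'(x)=T\Lambda(x)T^{-1}$ for all $x\in G$. *)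

theory Defs
  imports "Jordan_Normal_Form.VS_Connect"
begin

(* An n-ary operation on G is a function on lists, of which only the values on lists of
   length n over G matter.  Positions are counted from 0, so the usual
   f(x_1^{i-1}, f(x_i^{n+i-1}), x_{n+i}^{2n-1}) appears with i shifted down by one. *)
locale nary_group =
  fixes n :: nat and G :: "'a set" and f :: "'a list \<Rightarrow> 'a"
  assumes arity: "n \<ge> 2"
    and nonempty: "G \<noteq> {}"
    and closed: "\<And>xs. length xs = n \<Longrightarrow> set xs \<subseteq> G \<Longrightarrow> f xs \<in> G"
    and assoc: "\<And>xs i j. length xs = 2 * n - 1 \<Longrightarrow> set xs \<subseteq> G \<Longrightarrow> i < n \<Longrightarrow> j < n \<Longrightarrow>
        f (take i xs @ [f (take n (drop i xs))] @ drop (n + i) xs) =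
        f (take j xs @ [f (take n (drop j xs))] @ drop (n + j) xs)"
    and solvable: "\<And>x0 xs i. x0 \<in> G \<Longrightarrow> length xs = n \<Longrightarrow> set xs \<subseteq> G \<Longrightarrow> i < n \<Longrightarrow>
        \<exists>!z. z \<in> G \<and> f (xs[i := z]) = x0"

definition general_linear :: "nat \<Rightarrow> complex mat set" where
  "general_linear m = {A \<in> carrier_mat m m. invertible_mat A}"

(* Values of \<Lambda> outside G are irrelevant.  The foldr is the ordered product
   \<Lambda> x_1 * (\<Lambda> x_2 * ... * (\<Lambda> x_n * 1)). *)
definition is_representation ::
  "nat \<Rightarrow> 'a set \<Rightarrow> ('a list \<Rightarrow> 'a) \<Rightarrow> nat \<Rightarrow> ('a \<Rightarrow> complex mat) \<Rightarrow> bool" where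
  "is_representation n G f m \<Lambda> \<longleftrightarrow>
     m \<ge> 1 \<and> (\<forall>x\<in>G. \<Lambda> x \<in> general_linear m) \<and>
     (\<forall>xs. length xs = n \<and> set xs \<subseteq> G \<longrightarrow>
        \<Lambda> (f xs) = foldr (\<lambda>x A. \<Lambda> x * A) xs (1\<^sub>m m))"

definition is_irreducible_representation ::
  "nat \<Rightarrow> 'a set \<Rightarrow> ('a list \<Rightarrow> 'a) \<Rightarrow> nat \<Rightarrow> ('a \<Rightarrow> complex mat) \<Rightarrow> bool" where
  "is_irreducible_representation n G f m \<Lambda> \<longleftrightarrow>
     is_representation n G f m \<Lambda> \<and>
     (\<forall>W. subspace class_ring W (module_vec TYPE(complex) m) \<and>
          (\<forall>x\<in>G. \<forall>w\<in>W. \<Lambda> x *\<^sub>v w \<in> W) \<longrightarrow>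
          W = {0\<^sub>v m} \<or> W = carrier_vec m)"

(* Equivalence of two representations of the same degree m; S is the inverse of T. *)
definition equivalent_representations ::
  "'a set \<Rightarrow> nat \<Rightarrow> ('a \<Rightarrow> complex mat) \<Rightarrow> ('a \<Rightarrow> complex mat) \<Rightarrow> bool" where
  "equivalent_representations G m \<Lambda> \<Lambda>' \<longleftrightarrow>
     (\<exists>T\<in>general_linear m. \<exists>S\<in>carrier_mat m m.
        T * S = 1\<^sub>m m \<and> S * T = 1\<^sub>m m \<and> (\<forall>x\<in>G. \<Lambda>' x = T * \<Lambda> x * S))"

end

theory Submission
  imports Defs "Jordan_Normal_Form.Char_Poly" "HOL-Computational_Algebra.Fundamental_Theorem_Algebra"
begin

text \<open>The polyadic group \<open>G\<close> is a generating coset of a group \<open>H\<close> of order \<open>(n - 1) |G|\<close>, its Post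
  covering group, whose elements are the words over \<open>G\<close> up to having congruent lengths modulo
  \<open>n - 1\<close> and equal long products in every context. Sending a word to the product of the matrices of
  its letters extends every representation of \<open>G\<close> uniquely to \<open>H\<close>, with the same invariant subspaces
  and the same equivalences, so it remains to treat the finite group \<open>H\<close>.

  A block triangular form shows, by induction on the degree, that the character of every
  representation is a combination of irreducible characters with coefficients in the natural
  numbers; complete reducibility is not needed. Applied to the regular representation,
  orthogonality of characters identifies these coefficients as the degrees, and evaluation at the
  identity gives \<open>\<Sum> d\<^sub>i\<^sup>2 = |H|\<close>.

  For an irreducible \<open>\<rho>\<close> of degree \<open>d\<close>, Schur's lemma gives
  \<open>\<Sum> \<rho> (g h g\<inverse> h\<inverse>) = (|H| / d)\<^sup>2\<close>, the sum running over all \<open>g\<close> and \<open>h\<close>. Hence the rational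
  number \<open>(|H| / d)\<^sup>2\<close> is an eigenvalue of the integer matrix that counts, for \<open>x\<close> and \<open>y\<close>, the pairs
  \<open>(g, h)\<close> with \<open>g h g\<inverse> h\<inverse> x = y\<close>; so it is an integer, and \<open>d\<close> divides \<open>|H|\<close>.\<close>

section \<open>Linear algebra\<close>

definition tr :: "'a::comm_monoid_add mat \<Rightarrow> 'a" where
  "tr A = (\<Sum>i<dim_row A. A $$ (i, i))"

lemma tr_carrier: "A \<in> carrier_mat m n \<Longrightarrow> tr A = (\<Sum>i<m. A $$ (i, i))"
  by (auto simp: tr_def)

lemma index_mult_mat_sum:
  fixes A :: "'a::semiring_0 mat"
  assumes "A \<in> carrier_mat m n" "B \<in> carrier_mat n p" "i < m" "j < p"
  shows "(A * B) $$ (i, j) = (\<Sum>l<n. A $$ (i, l) * B $$ (l, j))"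
  using assms by (auto simp: scalar_prod_def atLeast0LessThan intro!: sum.cong)

lemma index_mult_mat_vec_sum:
  fixes A :: "'a::semiring_0 mat"
  assumes "A \<in> carrier_mat m n" "v \<in> carrier_vec n" "i < m"
  shows "(A *\<^sub>v v) $ i = (\<Sum>l<n. A $$ (i, l) * v $ l)"
  using assms by (auto simp: scalar_prod_def atLeast0LessThan intro!: sum.cong)

text \<open>The library versions leave the inner dimension as a schematic variable, which blocks
  their use as conditional rewrite rules.\<close>

lemma square_mult_closed [simp]:
  "A \<in> carrier_mat m m \<Longrightarrow> B \<in> carrier_mat m m \<Longrightarrow> A * B \<in> carrier_mat m m"
  by simp

lemma square_mult_vec_closed [simp]:
  "A \<in> carrier_mat m m \<Longrightarrow> v \<in> carrier_vec m \<Longrightarrow> A *\<^sub>v v \<in> carrier_vec m"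
  by simp

lemma square_one_mult [simp]:
  "(A :: 'a::semiring_1 mat) \<in> carrier_mat m m \<Longrightarrow> 1\<^sub>m m * A = A"
  "(A :: 'a::semiring_1 mat) \<in> carrier_mat m m \<Longrightarrow> A * 1\<^sub>m m = A"
  by simp_all

lemma mult_mat_zero_vec:
  fixes A :: "'a::semiring_0 mat"
  assumes "A \<in> carrier_mat m n"
  shows "A *\<^sub>v 0\<^sub>v n = 0\<^sub>v m"
  using assms by (intro eq_vecI) auto

lemma mult_mat_unit_vec:
  fixes A :: "'a::semiring_1 mat"
  assumes "A \<in> carrier_mat m n" "j < n"
  shows "A *\<^sub>v unit_vec n j = col A j"
  using assms by (intro eq_vecI) auto

lemma tr_mult_commute:
  fixes A :: "'a::comm_semiring_0 mat"
  assumes A: "A \<in> carrier_mat m n" and B: "B \<in> carrier_mat n m"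
  shows "tr (A * B) = tr (B * A)"
proof -
  have "tr (A * B) = (\<Sum>i<m. \<Sum>l<n. A $$ (i, l) * B $$ (l, i))"
    using assms by (auto simp: tr_def simp del: index_mult_mat(1)
        intro!: sum.cong index_mult_mat_sum[OF A B])
  also have "\<dots> = (\<Sum>l<n. \<Sum>i<m. A $$ (i, l) * B $$ (l, i))"
    by (rule sum.swap)
  also have "\<dots> = (\<Sum>l<n. (B * A) $$ (l, l))"
    by (intro sum.cong refl) (simp add: index_mult_mat_sum[OF B A] mult.commute del: index_mult_mat(1))
  finally show ?thesis using B by (simp add: tr_def)
qed

lemma tr_similar:
  fixes A :: "'a::comm_ring_1 mat"
  assumes [simp]: "A \<in> carrier_mat m m" "T \<in> carrier_mat m m" "S \<in> carrier_mat m m"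
    and ST: "S * T = 1\<^sub>m m"
  shows "tr (T * A * S) = tr A"
proof -
  have "tr (T * A * S) = tr (S * (T * A))"
    by (rule tr_mult_commute[of _ m m]) auto
  also have "S * (T * A) = (S * T) * A"
    by (rule assoc_mult_mat[symmetric, of _ m m _ m _ m]) auto
  finally show ?thesis by (simp add: ST)
qed

lemma tr_one: "tr (1\<^sub>m m :: 'a::semiring_1 mat) = of_nat m"
  by (simp add: tr_def)

section \<open>Subspaces and bases adapted to them\<close>

lemma subspace_vecI:
  fixes W :: "'a::field vec set"
  assumes "W \<subseteq> carrier_vec m" "0\<^sub>v m \<in> W" "\<And>v w. v \<in> W \<Longrightarrow> w \<in> W \<Longrightarrow> v + w \<in> W"
    "\<And>c v. v \<in> W \<Longrightarrow> c \<cdot>\<^sub>v v \<in> W"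
  shows "VectorSpace.subspace class_ring W (module_vec TYPE('a) m)"
  using assms
  by (auto simp: VectorSpace.subspace_def submodule_def vec_vs vec_module module_vec_simps)

lemma subspace_vecD:
  fixes W :: "'a::field vec set"
  assumes "VectorSpace.subspace class_ring W (module_vec TYPE('a) m)"
  shows "W \<subseteq> carrier_vec m" "0\<^sub>v m \<in> W" "\<And>v w. v \<in> W \<Longrightarrow> w \<in> W \<Longrightarrow> v + w \<in> W"
    "\<And>c v. v \<in> W \<Longrightarrow> c \<cdot>\<^sub>v v \<in> W"
  using assms
  by (auto simp: VectorSpace.subspace_def submodule_def vec_vs vec_module module_vec_simps)

lemma inverse_matI:
  fixes A :: "'a::field mat"
  assumes A: "A \<in> carrier_mat m m"
    and inj: "\<And>v. v \<in> carrier_vec m \<Longrightarrow> A *\<^sub>v v = 0\<^sub>v m \<Longrightarrow> v = 0\<^sub>v m"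
  obtains B where "B \<in> carrier_mat m m" "A * B = 1\<^sub>m m" "B * A = 1\<^sub>m m"
proof -
  have "det A \<noteq> 0"
    using det_0_iff_vec_prod_zero_field[OF A] inj by blast
  from det_non_zero_imp_unit[OF A this, of "()"] show ?thesis
    using that by (auto simp: Units_def ring_mat_def)
qed

lemma sum_diff_single:
  fixes f :: "nat \<Rightarrow> 'a::comm_monoid_add"
  assumes "p < m"
  shows "(\<Sum>i<m. f i) = f p + (\<Sum>i\<in>{..<m} - {p}. f i)"
  using assms by (simp add: sum.remove)

text \<open>The transposition matrix \<open>P\<close> is its own inverse, so reordering the columns
  of \<open>T\<close> by \<open>P\<close> is undone by reordering the rows of
  \<open>S\<close>.\<close>

lemma swap_columns_inverse:
  fixes T S :: "'a::field mat"
  assumes [simp]: "T \<in> carrier_mat m m" "S \<in> carrier_mat m m" and TS: "T * S = 1\<^sub>m m" and ST: "S * T = 1\<^sub>m m"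
    and "r < m" "p < m" "r \<noteq> p"
  defines "P \<equiv> swaprows_mat m r p :: 'a mat"
  shows "(T * P) * (P * S) = 1\<^sub>m m" "(P * S) * (T * P) = 1\<^sub>m m"
proof -
  have [simp]: "P \<in> carrier_mat m m" unfolding P_def by simp
  have PP: "P * P = 1\<^sub>m m" unfolding P_def by (rule swaprows_mat_inv) (use assms in auto)
  have "(T * P) * (P * S) = T * (P * P) * S"
    by (simp add: assoc_mult_mat[of _ m m _ m _ m])
  then show "(T * P) * (P * S) = 1\<^sub>m m" by (simp add: PP TS)
  then show "(P * S) * (T * P) = 1\<^sub>m m"
    by (rule mat_mult_left_right_inverse[rotated 2]) auto
qed

text \<open>Steinitz exchange. The coordinates of \<open>w\<close> in the basis formed by the
  columns of \<open>T\<close> are \<open>S *\<^sub>v w\<close>; a nonzero \<open>r\<close>-th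
  coordinate allows \<open>w\<close> to take the place of the \<open>r\<close>-th basis
  vector.\<close>

lemma replace_column:
  fixes T S :: "'a::field mat"
  assumes T[simp]: "T \<in> carrier_mat m m" and S[simp]: "S \<in> carrier_mat m m"
    and TS: "T * S = 1\<^sub>m m" and ST: "S * T = 1\<^sub>m m"
    and w[simp]: "w \<in> carrier_vec m" and r: "r < m" and v0: "(S *\<^sub>v w) $ r \<noteq> 0"
  obtains T' S' where "T' \<in> carrier_mat m m" "S' \<in> carrier_mat m m"
    "T' * S' = 1\<^sub>m m" "S' * T' = 1\<^sub>m m" "col T' r = w"
    "\<And>j. j < m \<Longrightarrow> j \<noteq> r \<Longrightarrow> col T' j = col T j"
proof -
  define v where "v = S *\<^sub>v w"
  have v[simp]: "v \<in> carrier_vec m" unfolding v_def by auto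
  \<comment> \<open>The identity with column \<open>r\<close> replaced by the coordinates of
    \<open>w\<close>: right multiplication by it changes only the \<open>r\<close>-th column of
    \<open>T\<close>, and turns it into \<open>T *\<^sub>v v = w\<close>.\<close>
  define E where "E = mat m m (\<lambda>(i, j). if j = r then v $ i else if i = j then 1 else 0)"
  have E[simp]: "E \<in> carrier_mat m m" unfolding E_def by simp
  define T' where "T' = T * E"
  have T'[simp]: "T' \<in> carrier_mat m m" unfolding T'_def by simp
  have colE: "col E r = v" "j < m \<Longrightarrow> j \<noteq> r \<Longrightarrow> col E j = unit_vec m j" for j
    using r by (auto simp: E_def carrier_vecD[OF v] intro!: eq_vecI)
  have colT': "col T' j = T *\<^sub>v col E j" if "j < m" for j
    using that unfolding T'_def by (simp add: col_mult2[of _ m m _ m])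
  have Tv: "T *\<^sub>v v = w"
    unfolding v_def by (simp add: TS assoc_mult_mat_vec[of _ m m _ m, symmetric])
  have "col T' r = w" using colT'[OF r] Tv by (simp add: colE)
  moreover have "col T' j = col T j" if "j < m" "j \<noteq> r" for j
    using colT'[OF that(1)] colE(2)[OF that] that mult_mat_unit_vec[OF T that(1)] by simp
  \<comment> \<open>Cancelling \<open>T\<close> leaves \<open>E *\<^sub>v u = 0\<close>. Row
    \<open>r\<close> reads \<open>v $ r * u $ r = 0\<close> with \<open>v $ r\<close> nonzero, so
    \<open>u $ r = 0\<close>, and then the other rows give \<open>u $ i = 0\<close>.\<close>
  moreover have "u = 0\<^sub>v m" if u[simp]: "u \<in> carrier_vec m" and "T' *\<^sub>v u = 0\<^sub>v m" for u
  proof -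
    have "S *\<^sub>v (T *\<^sub>v (E *\<^sub>v u)) = S *\<^sub>v 0\<^sub>v m"
      using that(2) unfolding T'_def by (simp add: assoc_mult_mat_vec[of _ m m _ m])
    then have "(S * T) *\<^sub>v (E *\<^sub>v u) = 0\<^sub>v m"
      by (simp add: assoc_mult_mat_vec[of _ m m _ m] mult_mat_zero_vec[OF S])
    then have Eu: "E *\<^sub>v u = 0\<^sub>v m" using mult_mat_vec_carrier[OF E u] by (simp add: ST)
    have E_i: "(E *\<^sub>v u) $ i = v $ i * u $ r + (if i = r then 0 else u $ i)" if "i < m" for i
    proof -
      have "(E *\<^sub>v u) $ i = (\<Sum>l<m. E $$ (i, l) * u $ l)"
        by (rule index_mult_mat_vec_sum[OF E u that])
      also have "\<dots> = E $$ (i, r) * u $ r + (\<Sum>l\<in>{..<m} - {r}. E $$ (i, l) * u $ l)"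
        by (rule sum_diff_single[OF r])
      also have "(\<Sum>l\<in>{..<m} - {r}. E $$ (i, l) * u $ l) = (\<Sum>l\<in>{..<m} - {r}. if i = l then u $ l else 0)"
        using that by (intro sum.cong) (auto simp: E_def)
      also have "\<dots> = (if i = r then 0 else u $ i)" using that by (simp add: sum.delta)
      finally show ?thesis using that r by (simp add: E_def)
    qed
    have "u $ r = 0" using E_i[OF r] v0 r by (simp add: Eu v_def)
    then have "u $ i = 0" if "i < m" for i using E_i[OF that] that by (auto simp: Eu split: if_splits)
    then show ?thesis by (intro eq_vecI) (use u in auto)
  qed
  ultimately show ?thesis
    using inverse_matI[OF T'] that[OF T'] by (metis (no_types, lifting))
qed

text \<open>Vanishing of the coordinates from \<open>r\<close> on makes \<open>T *\<^sub>v v\<close>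
  a combination of the first \<open>r\<close> columns. The induction on \<open>r\<close> splits off
  the last of them.\<close>

lemma subspace_lin_comb_columns:
  fixes W :: "'a::field vec set"
  assumes W: "VectorSpace.subspace class_ring W (module_vec TYPE('a) m)" and T[simp]: "T \<in> carrier_mat m m"
    and cols: "\<And>j. j < r \<Longrightarrow> col T j \<in> W" and "r \<le> m"
    and v: "v \<in> carrier_vec m" "\<And>i. r \<le> i \<Longrightarrow> i < m \<Longrightarrow> v $ i = 0"
  shows "T *\<^sub>v v \<in> W"
  using cols \<open>r \<le> m\<close> v
proof (induction r arbitrary: v)
  case 0
  then have "v = 0\<^sub>v m" by (intro eq_vecI) auto
  moreover have "T *\<^sub>v 0\<^sub>v m = 0\<^sub>v m" by (rule mult_mat_zero_vec) simp
  ultimately show ?case using subspace_vecD(2)[OF W] by simp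
next
  case (Suc r)
  define u where "u = vec m (\<lambda>i. if i = r then 0 else v $ i)"
  have u: "T *\<^sub>v u \<in> W"
    using Suc.prems by (intro Suc.IH) (auto simp: u_def)
  have "v = u + v $ r \<cdot>\<^sub>v unit_vec m r"
    using Suc.prems by (intro eq_vecI) (auto simp: u_def)
  then have "T *\<^sub>v v = T *\<^sub>v (u + v $ r \<cdot>\<^sub>v unit_vec m r)" by (rule arg_cong)
  also have "\<dots> = T *\<^sub>v u + v $ r \<cdot>\<^sub>v (T *\<^sub>v unit_vec m r)"
    by (simp add: mult_add_distrib_mat_vec[of _ m m] mult_mat_vec[of _ m m] u_def)
  also have "T *\<^sub>v unit_vec m r = col T r"
    using Suc.prems by (intro mult_mat_unit_vec[of _ m m]) auto
  finally show ?case
    using u Suc.prems subspace_vecD(3,4)[OF W] by auto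
qed

text \<open>The basis is chosen with as many leading vectors in \<open>W\<close> as possible; by
  maximality these span \<open>W\<close>, so that membership is the vanishing of the remaining
  coordinates.\<close>

lemma subspace_adapted_basis:
  fixes W :: "'a::field vec set"
  assumes W: "VectorSpace.subspace class_ring W (module_vec TYPE('a) m)"
  obtains r T S where "r \<le> m" "T \<in> carrier_mat m m" "S \<in> carrier_mat m m"
    "T * S = 1\<^sub>m m" "S * T = 1\<^sub>m m"
    "\<And>w. w \<in> carrier_vec m \<Longrightarrow> w \<in> W \<longleftrightarrow> (\<forall>i. r \<le> i \<and> i < m \<longrightarrow> (S *\<^sub>v w) $ i = 0)"
proof -
  define Q where "Q r T S \<longleftrightarrow> r \<le> m \<and> T \<in> carrier_mat m m \<and> S \<in> carrier_mat m m \<and>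
    T * S = 1\<^sub>m m \<and> S * T = 1\<^sub>m m \<and> (\<forall>j<r. col T j \<in> W)" for r T and S :: "'a mat"
  have "Q 0 (1\<^sub>m m) (1\<^sub>m m)" by (simp add: Q_def)
  then have ex: "\<exists>T S. Q 0 T S" by blast
  \<comment> \<open>The maximum exists: \<open>r = 0\<close> is attained by the identity matrix, and
    every admissible \<open>r\<close> is at most \<open>m\<close>.\<close>
  define r where "r = (GREATEST r. \<exists>T S. Q r T S)"
  have bd: "\<forall>r. (\<exists>T S. Q r T S) \<longrightarrow> r \<le> m" by (auto simp: Q_def)
  have "\<exists>T S. Q r T S" unfolding r_def using ex bd
    by (intro GreatestI_nat[where P = "\<lambda>r. \<exists>T S. Q r T S"]) auto
  then obtain T S where Q: "Q r T S" by blast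
  have max: "r' \<le> r" if "Q r' T' S'" for r' T' S'
    unfolding r_def by (rule Greatest_le_nat) (use that bd in auto)
  from Q have [simp]: "T \<in> carrier_mat m m" "S \<in> carrier_mat m m" and r: "r \<le> m"
    and TS: "T * S = 1\<^sub>m m" and ST: "S * T = 1\<^sub>m m" and cols: "\<And>j. j < r \<Longrightarrow> col T j \<in> W"
    by (auto simp: Q_def)
  have "w \<in> W \<longleftrightarrow> (\<forall>i. r \<le> i \<and> i < m \<longrightarrow> (S *\<^sub>v w) $ i = 0)" if [simp]: "w \<in> carrier_vec m" for w
  proof
    assume w: "w \<in> W"
    show "\<forall>i. r \<le> i \<and> i < m \<longrightarrow> (S *\<^sub>v w) $ i = 0"
    proof (rule ccontr)
      \<comment> \<open>A vector of \<open>W\<close> with a nonzero coordinate beyond the first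
        \<open>r\<close> could be exchanged into position \<open>r\<close>, giving
        \<open>Suc r\<close> columns in \<open>W\<close> against maximality.\<close>
      assume "\<not> ?thesis"
      then obtain p where p: "r \<le> p" "p < m" "(S *\<^sub>v w) $ p \<noteq> 0" by auto
      then have rm: "r < m" by simp
      \<comment> \<open>Columns \<open>r\<close> and \<open>p\<close> are swapped so that the
        nonzero coordinate sits at \<open>r\<close>; since \<open>r \<le> p\<close>, the first
        \<open>r\<close> columns stay in \<open>W\<close>.\<close>
      have "\<exists>T1 S1. Q r T1 S1 \<and> (S1 *\<^sub>v w) $ r \<noteq> 0"
      proof (cases "p = r")
        case True
        then show ?thesis using Q p by blast
      next
        case False
        define P :: "'a mat" where "P = swaprows_mat m r p"
        have [simp]: "P \<in> carrier_mat m m" unfolding P_def by simp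
        have inv: "(T * P) * (P * S) = 1\<^sub>m m" "(P * S) * (T * P) = 1\<^sub>m m"
          unfolding P_def by (rule swap_columns_inverse; use p rm False TS ST in auto)+
        have "col (T * P) j = col T j" if "j < r" for j
        proof -
          have "col (T * P) j = T *\<^sub>v col P j" using that rm by (simp add: col_mult2[of _ m m _ m])
          also have "col P j = unit_vec m j"
            using that rm p by (intro eq_vecI) (auto simp: P_def)
          finally show ?thesis using that rm by (simp add: mult_mat_unit_vec[of _ m m])
        qed
        then have "Q r (T * P) (P * S)" using inv r cols by (auto simp: Q_def)
        moreover have "((P * S) *\<^sub>v w) $ r = (S *\<^sub>v w) $ p"
        proof -
          have Sw: "S *\<^sub>v w \<in> carrier_vec m" by auto
          have "((P * S) *\<^sub>v w) $ r = (P *\<^sub>v (S *\<^sub>v w)) $ r"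
            by (simp add: assoc_mult_mat_vec[of _ m m _ m])
          also have "\<dots> = (\<Sum>l<m. P $$ (r, l) * (S *\<^sub>v w) $ l)"
            by (rule index_mult_mat_vec_sum[OF _ Sw rm]) simp
          also have "\<dots> = (\<Sum>l<m. if l = p then (S *\<^sub>v w) $ l else 0)"
            using p rm by (intro sum.cong) (auto simp: P_def)
          finally show ?thesis using p by (simp add: sum.delta)
        qed
        ultimately show ?thesis using p by metis
      qed
      then obtain T1 S1 where Q1: "Q r T1 S1" and v: "(S1 *\<^sub>v w) $ r \<noteq> 0" by blast
      from Q1 obtain T' S' where "T' \<in> carrier_mat m m" "S' \<in> carrier_mat m m"
        "T' * S' = 1\<^sub>m m" "S' * T' = 1\<^sub>m m" "col T' r = w"
        "\<And>j. j < m \<Longrightarrow> j \<noteq> r \<Longrightarrow> col T' j = col T1 j"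
        unfolding Q_def using replace_column[of T1 m S1 w r] v rm by auto
      then have "Q (Suc r) T' S'" using rm Q1 w by (auto simp: Q_def less_Suc_eq)
      from max[OF this] show False by simp
    qed
  next
    assume *: "\<forall>i. r \<le> i \<and> i < m \<longrightarrow> (S *\<^sub>v w) $ i = 0"
    have "T *\<^sub>v (S *\<^sub>v w) \<in> W"
      by (rule subspace_lin_comb_columns[OF W _ cols r]) (use * in auto)
    then show "w \<in> W" by (simp add: TS assoc_mult_mat_vec[of _ m m _ m, symmetric])
  qed
  then show ?thesis using that[of r T S] r TS ST by (simp del: index_mult_mat_vec)
qed

section \<open>Representations of finite groups\<close>

definition irreducible_on :: "'a set \<Rightarrow> nat \<Rightarrow> ('a \<Rightarrow> complex mat) \<Rightarrow> bool" where
  "irreducible_on X m \<rho> \<longleftrightarrow> m \<ge> 1 \<and> (\<forall>x\<in>X. \<rho> x \<in> carrier_mat m m) \<and>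
     (\<forall>W. VectorSpace.subspace class_ring W (module_vec TYPE(complex) m) \<and>
          (\<forall>x\<in>X. \<forall>w\<in>W. \<rho> x *\<^sub>v w \<in> W) \<longrightarrow>
          W = {0\<^sub>v m} \<or> W = carrier_vec m)"

lemma irreducible_onD:
  assumes "irreducible_on X m \<rho>" "VectorSpace.subspace class_ring W (module_vec TYPE(complex) m)"
    and "\<And>x w. x \<in> X \<Longrightarrow> w \<in> W \<Longrightarrow> \<rho> x *\<^sub>v w \<in> W"
  shows "W = {0\<^sub>v m} \<or> W = carrier_vec m"
  using assms unfolding irreducible_on_def by blast

lemma eq_zero_matI:
  fixes A :: "'a::semiring_1 mat"
  assumes A: "A \<in> carrier_mat m n" and 0: "\<And>v. v \<in> carrier_vec n \<Longrightarrow> A *\<^sub>v v = 0\<^sub>v m"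
  shows "A = 0\<^sub>m m n"
proof (rule eq_matI)
  fix i j assume "i < dim_row (0\<^sub>m m n :: 'a mat)" "j < dim_col (0\<^sub>m m n :: 'a mat)"
  then have ij: "i < m" "j < n" by auto
  have "A $$ (i, j) = (A *\<^sub>v unit_vec n j) $ i"
    using A ij by (simp add: mult_mat_unit_vec)
  then show "A $$ (i, j) = 0\<^sub>m m n $$ (i, j)" using 0[of "unit_vec n j"] ij by simp
qed (use A in auto)

text \<open>Kernel and image of the intertwiner \<open>A\<close> are invariant subspaces, so for
  nonzero \<open>A\<close> the kernel is zero and the image is everything.\<close>

theorem schur:
  fixes \<rho> \<sigma> :: "'a \<Rightarrow> complex mat"
  assumes \<rho>: "irreducible_on X m \<rho>" and \<sigma>: "irreducible_on X n \<sigma>"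
    and A: "A \<in> carrier_mat m n" and comm: "\<And>x. x \<in> X \<Longrightarrow> \<rho> x * A = A * \<sigma> x"
    and nz: "A \<noteq> 0\<^sub>m m n"
  obtains B where "n = m" "B \<in> carrier_mat m m" "A * B = 1\<^sub>m m" "B * A = 1\<^sub>m m"
proof -
  have \<rho>c: "\<rho> x \<in> carrier_mat m m" and \<sigma>c: "\<sigma> x \<in> carrier_mat n n" if "x \<in> X" for x
    using \<rho> \<sigma> that unfolding irreducible_on_def by auto
  have commv: "\<rho> x *\<^sub>v (A *\<^sub>v v) = A *\<^sub>v (\<sigma> x *\<^sub>v v)" if "x \<in> X" "v \<in> carrier_vec n" for x v
    using comm[OF that(1)] A \<rho>c[OF that(1)] \<sigma>c[OF that(1)] that(2)
    by (metis assoc_mult_mat_vec)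
  have Av: "A *\<^sub>v v \<in> carrier_vec m" if "v \<in> carrier_vec n" for v using A that by simp
  define K where "K = {v \<in> carrier_vec n. A *\<^sub>v v = 0\<^sub>v m}"
  have A0: "A *\<^sub>v 0\<^sub>v n = 0\<^sub>v m" using A by (rule mult_mat_zero_vec)
  have sK: "VectorSpace.subspace class_ring K (module_vec TYPE(complex) n)"
    by (rule subspace_vecI)
      (use A A0 in \<open>auto simp: K_def mult_add_distrib_mat_vec[of _ m n] mult_mat_vec[of _ m n]\<close>)
  have \<rho>0: "\<rho> x *\<^sub>v 0\<^sub>v m = 0\<^sub>v m" if "x \<in> X" for x
    using \<rho>c[OF that] by (rule mult_mat_zero_vec)
  have "\<sigma> x *\<^sub>v v \<in> K" if "x \<in> X" "v \<in> K" for x v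
    using that \<rho>0 \<sigma>c commv[of x v] by (auto simp: K_def intro!: square_mult_vec_closed)
  from irreducible_onD[OF \<sigma> sK this] have "K = {0\<^sub>v n} \<or> K = carrier_vec n" by blast
  moreover have "K \<noteq> carrier_vec n"
    using nz eq_zero_matI[OF A] by (auto simp: K_def)
  ultimately have K: "K = {0\<^sub>v n}" by blast
  define R where "R = (\<lambda>v. A *\<^sub>v v) ` carrier_vec n"
  have sR: "VectorSpace.subspace class_ring R (module_vec TYPE(complex) m)"
  proof (rule subspace_vecI)
    show "R \<subseteq> carrier_vec m" using Av by (auto simp: R_def)
    show "0\<^sub>v m \<in> R" unfolding R_def using A0 by (metis imageI zero_carrier_vec)
    show "v + w \<in> R" if vw: "v \<in> R" "w \<in> R" for v w
    proof -
      from vw obtain v' w' where "v = A *\<^sub>v v'" "w = A *\<^sub>v w'" "v' \<in> carrier_vec n" "w' \<in> carrier_vec n"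
        unfolding R_def by blast
      then have "v + w = A *\<^sub>v (v' + w')" "v' + w' \<in> carrier_vec n"
        using A by (auto simp: mult_add_distrib_mat_vec)
      then show ?thesis unfolding R_def by blast
    qed
    show "c \<cdot>\<^sub>v v \<in> R" if v: "v \<in> R" for c v
    proof -
      from v obtain v' where "v = A *\<^sub>v v'" "v' \<in> carrier_vec n"
        unfolding R_def by blast
      then have "c \<cdot>\<^sub>v v = A *\<^sub>v (c \<cdot>\<^sub>v v')" "c \<cdot>\<^sub>v v' \<in> carrier_vec n"
        using A by (auto simp: mult_mat_vec)
      then show ?thesis unfolding R_def by blast
    qed
  qed
  have "\<rho> x *\<^sub>v w \<in> R" if "x \<in> X" "w \<in> R" for x w
    using that commv[of x] square_mult_vec_closed[OF \<sigma>c] unfolding R_def by auto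
  from irreducible_onD[OF \<rho> sR this] have "R = {0\<^sub>v m} \<or> R = carrier_vec m" by blast
  moreover have "R \<noteq> {0\<^sub>v m}"
    using nz eq_zero_matI[OF A] unfolding R_def by blast
  ultimately have R: "R = carrier_vec m" by blast
  \<comment> \<open>Preimages of the unit vectors serve as the columns of a right inverse
    \<open>B\<close>.\<close>
  then have "\<forall>j. \<exists>v. v \<in> carrier_vec n \<and> A *\<^sub>v v = unit_vec m j"
    unfolding R_def by (metis imageE unit_vec_carrier)
  then obtain b where b: "\<And>j. b j \<in> carrier_vec n" "\<And>j. A *\<^sub>v b j = unit_vec m j"
    by metis
  define B where "B = mat n m (\<lambda>(i, j). b j $ i)"
  have B: "B \<in> carrier_mat n m" unfolding B_def by simp
  have colB: "col B j = b j" if "j < m" for j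
    using that carrier_vecD[OF b(1)[of j]] by (intro eq_vecI) (auto simp: B_def)
  have AB: "A * B = 1\<^sub>m m"
  proof (rule eq_matI)
    fix i j assume "i < dim_row (1\<^sub>m m :: complex mat)" "j < dim_col (1\<^sub>m m :: complex mat)"
    then have ij: "i < m" "j < m" by auto
    have "(A * B) $$ (i, j) = col (A * B) j $ i" using A B ij by simp
    also have "col (A * B) j = A *\<^sub>v b j"
      by (simp only: col_mult2[OF A B ij(2)] colB[OF ij(2)])
    finally show "(A * B) $$ (i, j) = 1\<^sub>m m $$ (i, j)" using ij by (simp add: b)
  qed (use A B in auto)
  have ker: "v = 0\<^sub>v n" if "v \<in> carrier_vec n" "A *\<^sub>v v = 0\<^sub>v m" for v
    using that K unfolding K_def by blast
  have BA: "B * A = 1\<^sub>m n"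
  proof -
    \<comment> \<open>\<open>A\<close> sends \<open>B *\<^sub>v (A *\<^sub>v v) - v\<close> to zero,
      and its kernel is trivial.\<close>
    have "B * A - 1\<^sub>m n = 0\<^sub>m n n"
    proof (rule eq_zero_matI)
      fix v :: "complex vec" assume v: "v \<in> carrier_vec n"
      have BAv: "B *\<^sub>v (A *\<^sub>v v) \<in> carrier_vec n" using A B v by simp
      have "A *\<^sub>v (B *\<^sub>v (A *\<^sub>v v) - v) = (A * B) *\<^sub>v (A *\<^sub>v v) - A *\<^sub>v v"
        using A B v BAv Av[OF v] by (simp add: mult_minus_distrib_mat_vec)
      then have "A *\<^sub>v (B *\<^sub>v (A *\<^sub>v v) - v) = 0\<^sub>v m" using Av[OF v] by (simp add: AB)
      from ker[OF _ this] have "B *\<^sub>v (A *\<^sub>v v) - v = 0\<^sub>v n" using BAv v by simp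
      then show "(B * A - 1\<^sub>m n) *\<^sub>v v = 0\<^sub>v n"
        using A B v BAv by (simp add: minus_mult_distrib_mat_vec[of _ n n])
    qed (use A B in auto)
    then have "(B * A - 1\<^sub>m n) + 1\<^sub>m n = 0\<^sub>m n n + 1\<^sub>m n" by simp
    then show ?thesis using A B by (simp add: minus_add_uminus_mat[of _ n n]
      assoc_add_mat[of _ n n] uminus_l_inv_mat[of _ n n])
  qed
  \<comment> \<open>Equality of the degrees comes from traces: \<open>A * B\<close> has trace
    \<open>m\<close>, \<open>B * A\<close> has trace \<open>n\<close>, and the two agree.\<close>
  have "of_nat m = (of_nat n :: complex)"
    using tr_mult_commute[OF A B] by (simp add: AB BA tr_one)
  then have "n = m" by simp
  then show ?thesis using that[of B] AB BA B by simp
qed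

text \<open>Over the complex numbers \<open>A\<close> has an eigenvalue \<open>c\<close>.
  Subtracting \<open>c\<close> from \<open>A\<close> leaves a matrix that still commutes with every
  \<open>\<rho> x\<close> and kills an eigenvector, so it is not invertible; by Schur's lemma it
  vanishes.\<close>

corollary schur_scalar:
  fixes \<rho> :: "'a \<Rightarrow> complex mat"
  assumes \<rho>: "irreducible_on X m \<rho>" and A: "A \<in> carrier_mat m m"
    and comm: "\<And>x. x \<in> X \<Longrightarrow> \<rho> x * A = A * \<rho> x"
  obtains c where "A = c \<cdot>\<^sub>m 1\<^sub>m m"
proof -
  have m: "m \<ge> 1" and \<rho>c: "x \<in> X \<Longrightarrow> \<rho> x \<in> carrier_mat m m" for x
    using \<rho> unfolding irreducible_on_def by auto
  have "degree (char_poly A) = m" using degree_monic_char_poly[OF A] by simp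
  then have "\<not> constant (poly (char_poly A))" using m by (simp add: constant_degree)
  then obtain c where "poly (char_poly A) c = 0" using fundamental_theorem_of_algebra by blast
  then have "eigenvalue A c" using eigenvalue_root_char_poly[OF A] by simp
  then obtain v where v: "v \<in> carrier_vec m" "v \<noteq> 0\<^sub>v m" "A *\<^sub>v v = c \<cdot>\<^sub>v v"
    using A unfolding eigenvalue_def eigenvector_def by auto
  define D where "D = A - c \<cdot>\<^sub>m 1\<^sub>m m"
  have D: "D \<in> carrier_mat m m" unfolding D_def by (intro minus_carrier_mat) simp
  have "\<rho> x * D = D * \<rho> x" if x: "x \<in> X" for x
    unfolding D_def using comm[OF x] \<rho>c[OF x] A
    by (simp add: mult_minus_distrib_mat[of _ m m _ m] minus_mult_distrib_mat[of _ m m _ _ m]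
        mult_smult_distrib[of _ m m _ m] mult_smult_assoc_mat[of _ m m _ m])
  note commD = this
  have "(c \<cdot>\<^sub>m 1\<^sub>m m) *\<^sub>v v = c \<cdot>\<^sub>v v" using v by (intro eq_vecI) auto
  then have Dv: "D *\<^sub>v v = 0\<^sub>v m"
    unfolding D_def using A v by (simp add: minus_mult_distrib_mat_vec[of _ m m])
  have "D = 0\<^sub>m m m"
  proof (rule ccontr)
    assume nz: "D \<noteq> 0\<^sub>m m m"
    from schur[OF \<rho> \<rho> D commD nz] obtain B
      where "B \<in> carrier_mat m m" "B * D = 1\<^sub>m m" by blast
    then have "v = B *\<^sub>v (D *\<^sub>v v)" using D v by (simp add: assoc_mult_mat_vec[of _ m m _ m, symmetric])
    also have "\<dots> = 0\<^sub>v m" using \<open>B \<in> _\<close> by (simp add: Dv mult_mat_zero_vec)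
    finally show False using v by simp
  qed
  then have "A = c \<cdot>\<^sub>m 1\<^sub>m m"
    unfolding D_def using A by (intro eq_matI) (auto dest!: arg_cong[where f = "\<lambda>X. X $$ _"] simp: mat_eq_iff)
  then show ?thesis using that by blast
qed

definition group_rep :: "('a, 'b) monoid_scheme \<Rightarrow> nat \<Rightarrow> ('a \<Rightarrow> complex mat) \<Rightarrow> bool" where
  "group_rep H m \<rho> \<longleftrightarrow> (\<forall>x\<in>carrier H. \<rho> x \<in> carrier_mat m m) \<and> \<rho> \<one>\<^bsub>H\<^esub> = 1\<^sub>m m \<and>
     (\<forall>x\<in>carrier H. \<forall>y\<in>carrier H. \<rho> (x \<otimes>\<^bsub>H\<^esub> y) = \<rho> x * \<rho> y)"

lemma group_repD:
  assumes "group_rep H m \<rho>"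
  shows "x \<in> carrier H \<Longrightarrow> \<rho> x \<in> carrier_mat m m" "\<rho> \<one>\<^bsub>H\<^esub> = 1\<^sub>m m"
    "x \<in> carrier H \<Longrightarrow> y \<in> carrier H \<Longrightarrow> \<rho> (x \<otimes>\<^bsub>H\<^esub> y) = \<rho> x * \<rho> y"
  using assms unfolding group_rep_def by auto

text \<open>The explicit dimensions give the sum a shape even over an empty index set; matrices of
  all dimensions share one type, so there is no common zero to sum from.\<close>

definition sum_mat :: "nat \<Rightarrow> nat \<Rightarrow> ('b \<Rightarrow> 'a::semiring_0 mat) \<Rightarrow> 'b set \<Rightarrow> 'a mat" where
  "sum_mat m n F X = mat m n (\<lambda>(i, j). \<Sum>x\<in>X. F x $$ (i, j))"

lemma sum_mat_carrier [simp]: "sum_mat m n F X \<in> carrier_mat m n"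
  by (simp add: sum_mat_def)

lemma mult_sum_mat:
  assumes A: "A \<in> carrier_mat p m" and F: "\<And>x. x \<in> X \<Longrightarrow> F x \<in> carrier_mat m n"
  shows "A * sum_mat m n F X = sum_mat p n (\<lambda>x. A * F x) X"
proof (rule eq_matI)
  fix i j assume "i < dim_row (sum_mat p n (\<lambda>x. A * F x) X)" "j < dim_col (sum_mat p n (\<lambda>x. A * F x) X)"
  then have ij: "i < p" "j < n" by (auto simp: sum_mat_def)
  have "(A * sum_mat m n F X) $$ (i, j) = (\<Sum>l<m. \<Sum>x\<in>X. A $$ (i, l) * F x $$ (l, j))"
    using ij by (subst index_mult_mat_sum[OF A _ ij, of _ ]) (auto simp: sum_mat_def sum_distrib_left)
  also have "\<dots> = (\<Sum>x\<in>X. \<Sum>l<m. A $$ (i, l) * F x $$ (l, j))" by (rule sum.swap)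
  also have "\<dots> = (\<Sum>x\<in>X. (A * F x) $$ (i, j))"
    using index_mult_mat_sum[OF A F ij] by (intro sum.cong) auto
  finally show "(A * sum_mat m n F X) $$ (i, j) = sum_mat p n (\<lambda>x. A * F x) X $$ (i, j)"
    using ij by (simp add: sum_mat_def)
qed (use A in \<open>auto simp: sum_mat_def\<close>)

lemma sum_mat_mult:
  assumes A: "A \<in> carrier_mat n p" and F: "\<And>x. x \<in> X \<Longrightarrow> F x \<in> carrier_mat m n"
  shows "sum_mat m n F X * A = sum_mat m p (\<lambda>x. F x * A) X"
proof (rule eq_matI)
  fix i j assume "i < dim_row (sum_mat m p (\<lambda>x. F x * A) X)" "j < dim_col (sum_mat m p (\<lambda>x. F x * A) X)"
  then have ij: "i < m" "j < p" by (auto simp: sum_mat_def)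
  have "(sum_mat m n F X * A) $$ (i, j) = (\<Sum>l<n. \<Sum>x\<in>X. F x $$ (i, l) * A $$ (l, j))"
    using ij by (subst index_mult_mat_sum[OF _ A ij]) (auto simp: sum_mat_def sum_distrib_right)
  also have "\<dots> = (\<Sum>x\<in>X. \<Sum>l<n. F x $$ (i, l) * A $$ (l, j))" by (rule sum.swap)
  also have "\<dots> = (\<Sum>x\<in>X. (F x * A) $$ (i, j))"
    using index_mult_mat_sum[OF F A ij] by (intro sum.cong) auto
  finally show "(sum_mat m n F X * A) $$ (i, j) = sum_mat m p (\<lambda>x. F x * A) X $$ (i, j)"
    using ij by (simp add: sum_mat_def)
qed (use A in \<open>auto simp: sum_mat_def\<close>)

lemma sum_mat_cong:
  "(\<And>x. x \<in> X \<Longrightarrow> F x = F' x) \<Longrightarrow> sum_mat m n F X = sum_mat m n F' X"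
  unfolding sum_mat_def by (auto intro!: cong_mat sum.cong)

lemma sum_mat_reindex:
  "bij_betw h X Y \<Longrightarrow> sum_mat m n (\<lambda>x. F (h x)) X = sum_mat m n F Y"
  unfolding sum_mat_def by (intro cong_mat) (auto intro: sum.reindex_bij_betw)

definition unit_mat :: "nat \<Rightarrow> nat \<Rightarrow> nat \<Rightarrow> nat \<Rightarrow> 'a::semiring_1 mat" where
  "unit_mat m n a b = mat m n (\<lambda>(i, j). if i = a \<and> j = b then 1 else 0)"

text \<open>A matrix unit between two factors picks out a single product of entries. Placed in an
  average over the group, it produces the sums of the orthogonality relations.\<close>

lemma index_mult_unit_mat_mult:
  fixes A B :: "'a::semiring_1 mat"
  assumes A: "A \<in> carrier_mat p m" and B: "B \<in> carrier_mat n q"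
    and "a < m" "b < n" "i < p" "j < q"
  shows "(A * unit_mat m n a b * B) $$ (i, j) = A $$ (i, a) * B $$ (b, j)"
proof -
  have U: "unit_mat m n a b \<in> carrier_mat m n" by (simp add: unit_mat_def)
  have AU: "(A * unit_mat m n a b) $$ (i, l) = (if l = b then A $$ (i, a) else 0)" if "l < n" for l
  proof -
    have "(A * unit_mat m n a b) $$ (i, l) = (\<Sum>k<m. A $$ (i, k) * unit_mat m n a b $$ (k, l))"
      by (rule index_mult_mat_sum[OF A U]) (use assms that in auto)
    also have "\<dots> = (\<Sum>k<m. if k = a then (if l = b then A $$ (i, k) else 0) else 0)"
      using that by (intro sum.cong) (auto simp: unit_mat_def)
    finally show ?thesis using assms by (simp add: sum.delta)
  qed
  have "(A * unit_mat m n a b * B) $$ (i, j) =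
      (\<Sum>l<n. (A * unit_mat m n a b) $$ (i, l) * B $$ (l, j))"
    by (rule index_mult_mat_sum[OF mult_carrier_mat[OF A U] B]) (use assms in auto)
  also have "\<dots> = (\<Sum>l<n. if l = b then A $$ (i, a) * B $$ (l, j) else 0)"
    by (intro sum.cong) (auto simp: AU simp del: index_mult_mat(1))
  finally show ?thesis using assms by (simp add: sum.delta)
qed

section \<open>Averaging over the group and the orthogonality relations\<close>

locale finite_group = group H for H (structure) +
  assumes finite_carrier: "finite (carrier H)"
begin

abbreviation N :: nat where "N \<equiv> card (carrier H)"

lemma N_pos: "N > 0"
  using finite_carrier by (simp add: card_gt_0_iff) blast

lemma bij_mult_left: "h \<in> carrier H \<Longrightarrow> bij_betw (\<lambda>g. h \<otimes> g) (carrier H) (carrier H)"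
  by (rule bij_betwI[where g = "\<lambda>g. inv h \<otimes> g"]) (auto simp: m_assoc[symmetric])

text \<open>The usual averaging operator without division by the group order; it turns any matrix
  into an intertwiner from \<open>\<sigma>\<close> to \<open>\<rho>\<close>.\<close>

definition average :: "nat \<Rightarrow> nat \<Rightarrow> ('a \<Rightarrow> complex mat) \<Rightarrow> ('a \<Rightarrow> complex mat) \<Rightarrow> complex mat \<Rightarrow> complex mat" where
  "average m n \<rho> \<sigma> B = sum_mat m n (\<lambda>g. \<rho> g * B * \<sigma> (inv g)) (carrier H)"

text \<open>Left multiplication by \<open>h\<close> permutes the group. Replacing \<open>g\<close>
  by \<open>h \<otimes> g\<close> absorbs \<open>\<rho> h\<close> on the left and releases
  \<open>\<sigma> h\<close> on the right.\<close>

lemma average_intertwines: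
  assumes \<rho>: "group_rep H m \<rho>" and \<sigma>: "group_rep H n \<sigma>" and B: "B \<in> carrier_mat m n"
    and h: "h \<in> carrier H"
  shows "\<rho> h * average m n \<rho> \<sigma> B = average m n \<rho> \<sigma> B * \<sigma> h"
proof -
  note [simp] = group_repD(1)[OF \<rho>] group_repD(1)[OF \<sigma>]
  have c: "\<rho> g * B * \<sigma> g' \<in> carrier_mat m n" if "g \<in> carrier H" "g' \<in> carrier H" for g g'
    using that B by (meson mult_carrier_mat group_repD(1)[OF \<rho>] group_repD(1)[OF \<sigma>])
  have "\<rho> h * average m n \<rho> \<sigma> B = sum_mat m n (\<lambda>g. \<rho> h * (\<rho> g * B * \<sigma> (inv g))) (carrier H)"
    unfolding average_def using h c by (intro mult_sum_mat) auto
  also have "\<dots> = sum_mat m n (\<lambda>g. \<rho> (h \<otimes> g) * B * \<sigma> (inv (h \<otimes> g)) * \<sigma> h) (carrier H)"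
  proof (rule sum_mat_cong)
    fix g assume g: "g \<in> carrier H"
    have "\<sigma> (inv (h \<otimes> g)) * \<sigma> h = \<sigma> (inv (h \<otimes> g) \<otimes> h)"
      using g h by (simp add: group_repD(3)[OF \<sigma>])
    also have "inv (h \<otimes> g) \<otimes> h = inv g" using g h by (simp add: inv_mult_group m_assoc)
    finally have 1: "\<sigma> (inv (h \<otimes> g)) * \<sigma> h = \<sigma> (inv g)" .
    have "\<rho> (h \<otimes> g) * B * \<sigma> (inv (h \<otimes> g)) * \<sigma> h = \<rho> (h \<otimes> g) * B * (\<sigma> (inv (h \<otimes> g)) * \<sigma> h)"
      using g h by (intro assoc_mult_mat[of _ m n _ n _ n] mult_carrier_mat[OF _ B]) auto
    also have "\<dots> = \<rho> h * \<rho> g * B * \<sigma> (inv g)"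
      using g h by (simp only: 1 group_repD(3)[OF \<rho>])
    also have "\<dots> = \<rho> h * (\<rho> g * B) * \<sigma> (inv g)"
      using g h B by (subst assoc_mult_mat[of _ m m _ m _ n]) auto
    also have "\<dots> = \<rho> h * (\<rho> g * B * \<sigma> (inv g))"
      using g h by (intro assoc_mult_mat[of _ m m _ n _ n] mult_carrier_mat[OF _ B]) auto
    finally show "\<rho> h * (\<rho> g * B * \<sigma> (inv g)) = \<rho> (h \<otimes> g) * B * \<sigma> (inv (h \<otimes> g)) * \<sigma> h" by simp
  qed
  also have "\<dots> = sum_mat m n (\<lambda>g. \<rho> g * B * \<sigma> (inv g) * \<sigma> h) (carrier H)"
    by (rule sum_mat_reindex[OF bij_mult_left[OF h]])
  also have "\<dots> = average m n \<rho> \<sigma> B * \<sigma> h"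
    unfolding average_def using h c by (intro sum_mat_mult[symmetric]) auto
  finally show ?thesis .
qed

lemma index_average_unit_mat:
  assumes \<rho>: "group_rep H m \<rho>" and \<sigma>: "group_rep H n \<sigma>"
    and "a < m" "b < n" "i < m" "j < n"
  shows "average m n \<rho> \<sigma> (unit_mat m n a b) $$ (i, j) =
    (\<Sum>g\<in>carrier H. \<rho> g $$ (i, a) * \<sigma> (inv g) $$ (b, j))"
  using assms group_repD(1)[OF \<rho>] group_repD(1)[OF \<sigma>] unfolding average_def sum_mat_def
  by (simp del: index_mult_mat(1)) (intro sum.cong refl index_mult_unit_mat_mult; auto)

text \<open>The sum is an entry of the average of a matrix unit. By Schur's lemma a nonzero average
  would be invertible and conjugate \<open>\<sigma>\<close> into \<open>\<rho>\<close>. The value at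
  \<open>inv g\<close> stands where the unitary form of the relation has a complex
  conjugate.\<close>

theorem orthogonality_inequivalent:
  assumes \<rho>: "group_rep H m \<rho>" "irreducible_on (carrier H) m \<rho>"
    and \<sigma>: "group_rep H n \<sigma>" "irreducible_on (carrier H) n \<sigma>"
    and ineq: "\<not> (m = n \<and> equivalent_representations (carrier H) m \<sigma> \<rho>)"
    and ij: "a < m" "b < n" "i < m" "j < n"
  shows "(\<Sum>g\<in>carrier H. \<rho> g $$ (i, a) * \<sigma> (inv g) $$ (b, j)) = 0"
proof -
  define A where "A = average m n \<rho> \<sigma> (unit_mat m n a b)"
  have U: "unit_mat m n a b \<in> carrier_mat m n" by (simp add: unit_mat_def)
  have A: "A \<in> carrier_mat m n" by (simp add: A_def average_def)
  have comm: "\<rho> x * A = A * \<sigma> x" if "x \<in> carrier H" for x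
    unfolding A_def using average_intertwines[OF \<rho>(1) \<sigma>(1) U that] .
  have "A = 0\<^sub>m m n"
  proof (rule ccontr)
    assume "A \<noteq> 0\<^sub>m m n"
    from schur[OF \<rho>(2) \<sigma>(2) A comm this] obtain B
      where B: "n = m" "B \<in> carrier_mat m m" "A * B = 1\<^sub>m m" "B * A = 1\<^sub>m m" by blast
    have A': "A \<in> carrier_mat m m" using A B by simp
    have "invertible_mat A"
      using A' B unfolding invertible_mat_def inverts_mat_def by auto
    moreover have "\<rho> x = A * \<sigma> x * B" if x: "x \<in> carrier H" for x
    proof -
      have "A * \<sigma> x * B = \<rho> x * A * B" using comm[OF x] by simp
      also have "\<dots> = \<rho> x * (A * B)" using A' B x group_repD(1)[OF \<rho>(1) x] by simp
      finally show ?thesis using B group_repD(1)[OF \<rho>(1) x] by simp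
    qed
    ultimately have "equivalent_representations (carrier H) m \<sigma> \<rho>"
      unfolding equivalent_representations_def general_linear_def using A' B by blast
    with ineq B show False by simp
  qed
  then have "A $$ (i, j) = 0" using ij by simp
  then show ?thesis unfolding A_def using index_average_unit_mat[OF \<rho>(1) \<sigma>(1) ij] by simp
qed

text \<open>For a single irreducible representation the average is a scalar matrix, and its scalar
  is found from its trace.\<close>

theorem orthogonality_same:
  assumes \<rho>: "group_rep H m \<rho>" "irreducible_on (carrier H) m \<rho>"
    and ij: "a < m" "b < m" "i < m" "j < m"
  shows "(\<Sum>g\<in>carrier H. \<rho> g $$ (i, a) * \<rho> (inv g) $$ (b, j)) =
    (if i = j \<and> a = b then of_nat N / of_nat m else 0)"
proof -
  define A where "A = average m m \<rho> \<rho> (unit_mat m m a b)"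
  have U: "unit_mat m m a b \<in> carrier_mat m m" by (simp add: unit_mat_def)
  have A: "A \<in> carrier_mat m m" by (simp add: A_def average_def)
  have comm: "\<rho> x * A = A * \<rho> x" if "x \<in> carrier H" for x
    unfolding A_def using average_intertwines[OF \<rho>(1) \<rho>(1) U that] .
  obtain c where c: "A = c \<cdot>\<^sub>m 1\<^sub>m m" using schur_scalar[OF \<rho>(2) A comm] by blast
  have idx: "A $$ (i, j) = (\<Sum>g\<in>carrier H. \<rho> g $$ (i, a) * \<rho> (inv g) $$ (b, j))"
    if "i < m" "j < m" for i j
    unfolding A_def by (rule index_average_unit_mat[OF \<rho>(1) \<rho>(1)]) (use ij that in auto)
  \<comment> \<open>The trace of \<open>A\<close> is \<open>m * c\<close>. Summing over
    \<open>i\<close> first joins the two factors into \<open>\<rho> (inv g) * \<rho> g = 1\<close>,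
    so each group element contributes the entry \<open>(b, a)\<close> of the identity
    matrix.\<close>
  have "of_nat m * c = (\<Sum>i<m. A $$ (i, i))" by (simp add: c)
  also have "\<dots> = (\<Sum>i<m. \<Sum>g\<in>carrier H. \<rho> (inv g) $$ (b, i) * \<rho> g $$ (i, a))"
    by (intro sum.cong) (auto simp: idx mult.commute)
  also have "\<dots> = (\<Sum>g\<in>carrier H. \<Sum>i<m. \<rho> (inv g) $$ (b, i) * \<rho> g $$ (i, a))"
    by (rule sum.swap)
  also have "\<dots> = (\<Sum>g\<in>carrier H. 1\<^sub>m m $$ (b, a))"
  proof (rule sum.cong[OF refl])
    fix g assume g: "g \<in> carrier H"
    have "(\<Sum>i<m. \<rho> (inv g) $$ (b, i) * \<rho> g $$ (i, a)) = (\<rho> (inv g) * \<rho> g) $$ (b, a)"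
      using g by (intro index_mult_mat_sum[of _ m m _ m, symmetric])
        (auto simp: group_repD(1)[OF \<rho>(1)] ij)
    also have "\<rho> (inv g) * \<rho> g = 1\<^sub>m m"
      using g group_repD(3)[OF \<rho>(1), of "inv g" g] by (simp add: group_repD(2)[OF \<rho>(1)])
    finally show "(\<Sum>i<m. \<rho> (inv g) $$ (b, i) * \<rho> g $$ (i, a)) = 1\<^sub>m m $$ (b, a)" .
  qed
  also have "\<dots> = (if a = b then of_nat N else 0)" using ij by simp
  finally have cv: "c = (if a = b then of_nat N / of_nat m else 0)"
    using ij by (auto simp: field_simps split: if_splits)
  show ?thesis unfolding idx[OF ij(3,4), symmetric] using ij by (simp add: c cv)
qed

corollary character_orthogonality_inequivalent:
  assumes \<rho>: "group_rep H m \<rho>" "irreducible_on (carrier H) m \<rho>"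
    and \<sigma>: "group_rep H n \<sigma>" "irreducible_on (carrier H) n \<sigma>"
    and ineq: "\<not> (m = n \<and> equivalent_representations (carrier H) m \<sigma> \<rho>)"
  shows "(\<Sum>g\<in>carrier H. tr (\<rho> g) * tr (\<sigma> (inv g))) = 0"
proof -
  have "(\<Sum>g\<in>carrier H. tr (\<rho> g) * tr (\<sigma> (inv g))) =
      (\<Sum>g\<in>carrier H. \<Sum>i<m. \<Sum>j<n. \<rho> g $$ (i, i) * \<sigma> (inv g) $$ (j, j))"
    by (intro sum.cong refl)
      (simp add: tr_carrier[OF group_repD(1)[OF \<rho>(1)]] tr_carrier[OF group_repD(1)[OF \<sigma>(1)]] sum_product)
  also have "\<dots> = (\<Sum>i<m. \<Sum>g\<in>carrier H. \<Sum>j<n. \<rho> g $$ (i, i) * \<sigma> (inv g) $$ (j, j))"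
    by (rule sum.swap)
  also have "\<dots> = (\<Sum>i<m. \<Sum>j<n. \<Sum>g\<in>carrier H. \<rho> g $$ (i, i) * \<sigma> (inv g) $$ (j, j))"
    by (intro sum.cong refl sum.swap)
  also have "\<dots> = 0"
    using orthogonality_inequivalent[OF assms] by simp
  finally show ?thesis .
qed

corollary character_orthogonality_same:
  assumes \<rho>: "group_rep H m \<rho>" "irreducible_on (carrier H) m \<rho>"
  shows "(\<Sum>g\<in>carrier H. tr (\<rho> g) * tr (\<rho> (inv g))) = of_nat N"
proof -
  have m: "m \<ge> 1" using \<rho>(2) by (simp add: irreducible_on_def)
  have "(\<Sum>g\<in>carrier H. tr (\<rho> g) * tr (\<rho> (inv g))) =
      (\<Sum>g\<in>carrier H. \<Sum>i<m. \<Sum>j<m. \<rho> g $$ (i, i) * \<rho> (inv g) $$ (j, j))"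
    by (intro sum.cong refl) (simp add: tr_carrier[OF group_repD(1)[OF \<rho>(1)]] sum_product)
  also have "\<dots> = (\<Sum>i<m. \<Sum>g\<in>carrier H. \<Sum>j<m. \<rho> g $$ (i, i) * \<rho> (inv g) $$ (j, j))"
    by (rule sum.swap)
  also have "\<dots> = (\<Sum>i<m. \<Sum>j<m. \<Sum>g\<in>carrier H. \<rho> g $$ (i, i) * \<rho> (inv g) $$ (j, j))"
    by (intro sum.cong refl sum.swap)
  also have "\<dots> = (\<Sum>i<m. \<Sum>j<m. if i = j then of_nat N / of_nat m else 0)"
    using orthogonality_same[OF assms] by (intro sum.cong) auto
  also have "\<dots> = of_nat N" using m by simp
  finally show ?thesis .
qed

end

section \<open>Decomposition of characters and the sum of squares\<close>

lemma sum_lessThan_add: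
  fixes f :: "nat \<Rightarrow> 'a::comm_monoid_add"
  shows "(\<Sum>i<r + s. f i) = (\<Sum>i<r. f i) + (\<Sum>i<s. f (r + i))"
  by (induction s) (auto simp: add.assoc)

lemma group_rep_conjugate:
  assumes \<rho>: "group_rep H m \<rho>" and [simp]: "T \<in> carrier_mat m m" "S \<in> carrier_mat m m"
    and TS: "T * S = 1\<^sub>m m" and ST: "S * T = 1\<^sub>m m"
  shows "group_rep H m (\<lambda>x. S * \<rho> x * T)"
  unfolding group_rep_def
proof (intro conjI ballI)
  note [simp] = group_repD(1)[OF \<rho>]
  show "S * \<rho> x * T \<in> carrier_mat m m" if "x \<in> carrier H" for x using that by simp
  show "S * \<rho> \<one>\<^bsub>H\<^esub> * T = 1\<^sub>m m" by (simp add: group_repD(2)[OF \<rho>] ST)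
  fix x y assume xy: "x \<in> carrier H" "y \<in> carrier H"
  have "S * \<rho> x * T * (S * \<rho> y * T) = S * \<rho> x * (T * S) * (\<rho> y * T)"
    using xy by (simp add: assoc_mult_mat[of _ m m _ m _ m])
  also have "\<dots> = S * \<rho> x * (\<rho> y * T)" using xy by (simp add: TS)
  also have "\<dots> = S * (\<rho> x * \<rho> y) * T" using xy by (simp add: assoc_mult_mat[of _ m m _ m _ m])
  finally show "S * \<rho> (x \<otimes>\<^bsub>H\<^esub> y) * T = S * \<rho> x * T * (S * \<rho> y * T)"
    using xy by (simp add: group_repD(3)[OF \<rho>])
qed

context finite_group
begin

text \<open>When the lower left block vanishes, the diagonal blocks of a product are the products of
  the diagonal blocks.\<close>

lemma group_rep_diagonal_blocks:
  assumes \<sigma>: "group_rep H (r + s) \<sigma>"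
    and 0: "\<And>x i j. x \<in> carrier H \<Longrightarrow> r \<le> i \<Longrightarrow> i < r + s \<Longrightarrow> j < r \<Longrightarrow> \<sigma> x $$ (i, j) = 0"
  shows "group_rep H r (\<lambda>x. mat r r (\<lambda>(i, j). \<sigma> x $$ (i, j)))"
    and "group_rep H s (\<lambda>x. mat s s (\<lambda>(i, j). \<sigma> x $$ (r + i, r + j)))"
proof -
  have mul: "\<sigma> (x \<otimes> y) $$ (i, j) =
      (\<Sum>l<r. \<sigma> x $$ (i, l) * \<sigma> y $$ (l, j)) + (\<Sum>l<s. \<sigma> x $$ (i, r + l) * \<sigma> y $$ (r + l, j))"
    if "x \<in> carrier H" "y \<in> carrier H" "i < r + s" "j < r + s" for x y i j
    using index_mult_mat_sum[OF group_repD(1)[OF \<sigma> that(1)] group_repD(1)[OF \<sigma> that(2)] that(3,4)]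
    by (simp only: group_repD(3)[OF \<sigma> that(1,2)] sum_lessThan_add)
  show "group_rep H r (\<lambda>x. mat r r (\<lambda>(i, j). \<sigma> x $$ (i, j)))" (is "group_rep H r ?\<alpha>")
    unfolding group_rep_def
  proof (intro conjI ballI)
    show "?\<alpha> \<one> = 1\<^sub>m r" by (rule eq_matI) (auto simp: group_repD(2)[OF \<sigma>])
    fix x y assume xy: "x \<in> carrier H" "y \<in> carrier H"
    show "?\<alpha> (x \<otimes> y) = ?\<alpha> x * ?\<alpha> y"
    proof (rule eq_matI)
      fix i j assume "i < dim_row (?\<alpha> x * ?\<alpha> y)" "j < dim_col (?\<alpha> x * ?\<alpha> y)"
      then have ij: "i < r" "j < r" by auto
      have "(?\<alpha> x * ?\<alpha> y) $$ (i, j) = (\<Sum>l<r. ?\<alpha> x $$ (i, l) * ?\<alpha> y $$ (l, j))"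
        by (rule index_mult_mat_sum) (use ij in auto)
      also have "\<dots> = ?\<alpha> (x \<otimes> y) $$ (i, j)"
        using xy ij by (simp add: mul 0)
      finally show "?\<alpha> (x \<otimes> y) $$ (i, j) = (?\<alpha> x * ?\<alpha> y) $$ (i, j)" by simp
    qed auto
  qed simp
  show "group_rep H s (\<lambda>x. mat s s (\<lambda>(i, j). \<sigma> x $$ (r + i, r + j)))" (is "group_rep H s ?\<beta>")
    unfolding group_rep_def
  proof (intro conjI ballI)
    show "?\<beta> \<one> = 1\<^sub>m s" by (rule eq_matI) (auto simp: group_repD(2)[OF \<sigma>])
    fix x y assume xy: "x \<in> carrier H" "y \<in> carrier H"
    show "?\<beta> (x \<otimes> y) = ?\<beta> x * ?\<beta> y"
    proof (rule eq_matI)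
      fix i j assume "i < dim_row (?\<beta> x * ?\<beta> y)" "j < dim_col (?\<beta> x * ?\<beta> y)"
      then have ij: "i < s" "j < s" by auto
      have "(?\<beta> x * ?\<beta> y) $$ (i, j) = (\<Sum>l<s. ?\<beta> x $$ (i, l) * ?\<beta> y $$ (l, j))"
        by (rule index_mult_mat_sum) (use ij in auto)
      also have "\<dots> = ?\<beta> (x \<otimes> y) $$ (i, j)"
        using xy ij by (simp add: mul 0)
      finally show "?\<beta> (x \<otimes> y) $$ (i, j) = (?\<beta> x * ?\<beta> y) $$ (i, j)" by simp
    qed auto
  qed simp
qed

text \<open>In a basis adapted to a proper nonzero invariant subspace the matrices are block
  triangular, and the trace is the sum of the traces of the two diagonal blocks.\<close>

lemma reducible_character_split:
  assumes \<rho>: "group_rep H m \<rho>" and m: "m \<ge> 1" and red: "\<not> irreducible_on (carrier H) m \<rho>"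
  obtains r s \<alpha> \<beta> where "r < m" "s < m" "group_rep H r \<alpha>" "group_rep H s \<beta>"
    "\<And>x. x \<in> carrier H \<Longrightarrow> tr (\<rho> x) = tr (\<alpha> x) + tr (\<beta> x)"
proof -
  note [simp] = group_repD(1)[OF \<rho>]
  obtain W where W: "VectorSpace.subspace class_ring W (module_vec TYPE(complex) m)"
    and inv: "\<And>x w. x \<in> carrier H \<Longrightarrow> w \<in> W \<Longrightarrow> \<rho> x *\<^sub>v w \<in> W"
    and ne: "W \<noteq> {0\<^sub>v m}" "W \<noteq> carrier_vec m"
    using m red unfolding irreducible_on_def by auto
  obtain r T S where r: "r \<le> m" and [simp]: "T \<in> carrier_mat m m" "S \<in> carrier_mat m m"
    and TS: "T * S = 1\<^sub>m m" and ST: "S * T = 1\<^sub>m m"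
    and WS: "\<And>w. w \<in> carrier_vec m \<Longrightarrow> w \<in> W \<longleftrightarrow> (\<forall>i. r \<le> i \<and> i < m \<longrightarrow> (S *\<^sub>v w) $ i = 0)"
    using subspace_adapted_basis[OF W] by blast
  \<comment> \<open>With \<open>r = m\<close> the criterion for membership in \<open>W\<close> would
    be empty and \<open>W\<close> the whole space; with \<open>r = 0\<close>, excluded next, every
    vector of \<open>W\<close> would have all coordinates zero.\<close>
  have "r \<noteq> m"
  proof
    assume "r = m"
    then have "carrier_vec m \<subseteq> W" using WS by (meson leD subsetI)
    then show False using ne subspace_vecD(1)[OF W] by blast
  qed
  define s where "s = m - r"
  have s: "m = r + s" "s > 0" using r \<open>r \<noteq> m\<close> by (auto simp: s_def)
  have "r \<noteq> 0"
  proof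
    assume "r = 0"
    have "w = 0\<^sub>v m" if w: "w \<in> W" for w
    proof -
      have wc: "w \<in> carrier_vec m" using w subspace_vecD(1)[OF W] by auto
      have "S *\<^sub>v w = 0\<^sub>v m"
      proof (rule eq_vecI)
        fix i assume "i < dim_vec (0\<^sub>v m :: complex vec)"
        then show "(S *\<^sub>v w) $ i = 0\<^sub>v m $ i"
          using iffD1[OF WS[OF wc] w] \<open>r = 0\<close> by (simp del: index_mult_mat_vec)
      qed (simp add: carrier_matD[of S m m])
      then have "T *\<^sub>v (S *\<^sub>v w) = 0\<^sub>v m" by (simp add: mult_mat_zero_vec[of _ m m])
      then show ?thesis using wc by (simp add: TS assoc_mult_mat_vec[of _ m m _ m, symmetric])
    qed
    then show False using ne subspace_vecD(2)[OF W] by blast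
  qed
  define \<sigma> where "\<sigma> x = S * \<rho> x * T" for x
  have \<sigma>: "group_rep H (r + s) \<sigma>"
    using group_rep_conjugate[OF \<rho> _ _ TS ST] unfolding \<sigma>_def s(1)[symmetric] by simp
  \<comment> \<open>The basis vector \<open>col T j\<close> with \<open>j < r\<close> lies in
    \<open>W\<close>, and so does its image under \<open>\<rho> x\<close>. The entry
    \<open>(i, j)\<close> of \<open>\<sigma> x\<close> is the coordinate of that image at
    \<open>i \<ge> r\<close>, hence zero.\<close>
  have z: "\<sigma> x $$ (i, j) = 0" if x: "x \<in> carrier H" and ij: "r \<le> i" "i < r + s" "j < r" for x i j
  proof -
    have jm: "j < m" "i < m" using ij s by auto
    have cT: "col T j \<in> carrier_vec m" using jm(1) \<open>T \<in> carrier_mat m m\<close> by (rule col_carrier_vec)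
    have "S *\<^sub>v col T j = col (S * T) j" using jm by (simp add: col_mult2[of _ m m _ m])
    also have "\<dots> = unit_vec m j" using jm by (simp add: ST)
    finally have "col T j \<in> W"
      using ij jm by (intro iffD2[OF WS[OF cT]]) (simp del: index_mult_mat_vec)
    then have w: "\<rho> x *\<^sub>v col T j \<in> W" using inv x by blast
    have "\<sigma> x $$ (i, j) = col (S * (\<rho> x * T)) j $ i"
      using jm x unfolding \<sigma>_def
      by (simp add: assoc_mult_mat[of _ m m _ m _ m] carrier_matD[of S m m] carrier_matD[of T m m]
          del: index_mult_mat(1))
    also have "col (S * (\<rho> x * T)) j = S *\<^sub>v (\<rho> x *\<^sub>v col T j)"
      using jm x by (simp add: col_mult2[of _ m m _ m])
    also have "\<dots> $ i = 0"
      using iffD1[OF WS w] x cT ij jm by (simp del: index_mult_mat_vec)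
    finally show ?thesis .
  qed
  have "tr (\<rho> x) = tr (mat r r (\<lambda>(i, j). \<sigma> x $$ (i, j))) + tr (mat s s (\<lambda>(i, j). \<sigma> x $$ (r + i, r + j)))"
    if x: "x \<in> carrier H" for x
  proof -
    have "tr (\<rho> x) = tr (\<sigma> x)" unfolding \<sigma>_def by (rule tr_similar[symmetric]) (use x TS in auto)
    also have "\<dots> = (\<Sum>i<r + s. \<sigma> x $$ (i, i))" by (rule tr_carrier[OF group_repD(1)[OF \<sigma> x]])
    finally show ?thesis by (simp add: sum_lessThan_add tr_def)
  qed
  moreover have "r < m" "s < m" using s \<open>r \<noteq> 0\<close> by auto
  ultimately show ?thesis
    using that[OF _ _ group_rep_diagonal_blocks[OF \<sigma> z]] by blast
qed

text \<open>Strong induction on the degree: a reducible character splits into two of smaller degree,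
  whose coefficients are added.\<close>

lemma character_decomposition:
  fixes \<Lambda> :: "'i \<Rightarrow> 'a \<Rightarrow> complex mat"
  assumes exh: "\<And>m \<rho>. group_rep H m \<rho> \<Longrightarrow> irreducible_on (carrier H) m \<rho> \<Longrightarrow>
      \<exists>i\<in>I. \<forall>x\<in>carrier H. tr (\<rho> x) = tr (\<Lambda> i x)"
    and fin: "finite I" and \<rho>: "group_rep H m \<rho>"
  shows "\<exists>c :: 'i \<Rightarrow> nat. \<forall>x\<in>carrier H. tr (\<rho> x) = (\<Sum>i\<in>I. of_nat (c i) * tr (\<Lambda> i x))"
  using \<rho>
proof (induction m arbitrary: \<rho> rule: less_induct)
  case (less m)
  consider "m = 0" | "m \<ge> 1" "irreducible_on (carrier H) m \<rho>" | "m \<ge> 1" "\<not> irreducible_on (carrier H) m \<rho>"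
    by linarith
  then show ?case
  proof cases
    case 1
    then have "tr (\<rho> x) = 0" if "x \<in> carrier H" for x
      using tr_carrier[OF group_repD(1)[OF less.prems that]] by simp
    then show ?thesis by (intro exI[of _ "\<lambda>_. 0"]) simp
  next
    case 2
    then obtain i where "i \<in> I" "\<forall>x\<in>carrier H. tr (\<rho> x) = tr (\<Lambda> i x)"
      using exh less.prems by blast
    moreover have "(\<Sum>j\<in>I. of_nat (if j = i then 1 else 0) * tr (\<Lambda> j x)) = tr (\<Lambda> i x)" for x
    proof -
      have "(\<Sum>j\<in>I. of_nat (if j = i then 1 else 0) * tr (\<Lambda> j x)) = (\<Sum>j\<in>I. if j = i then tr (\<Lambda> j x) else 0)"
        by (intro sum.cong) auto
      then show ?thesis using fin \<open>i \<in> I\<close> by simp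
    qed
    ultimately show ?thesis by (intro exI[of _ "\<lambda>j. if j = i then 1 else 0"]) metis
  next
    case 3
    obtain r s \<alpha> \<beta> where rs: "r < m" "s < m" "group_rep H r \<alpha>" "group_rep H s \<beta>"
      and tr: "\<And>x. x \<in> carrier H \<Longrightarrow> tr (\<rho> x) = tr (\<alpha> x) + tr (\<beta> x)"
      using reducible_character_split[OF less.prems 3] by blast
    from less.IH[OF rs(1,3)] less.IH[OF rs(2,4)] obtain c c' :: "'i \<Rightarrow> nat"
      where "\<forall>x\<in>carrier H. tr (\<alpha> x) = (\<Sum>i\<in>I. of_nat (c i) * tr (\<Lambda> i x))"
        "\<forall>x\<in>carrier H. tr (\<beta> x) = (\<Sum>i\<in>I. of_nat (c' i) * tr (\<Lambda> i x))" by blast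
    then show ?thesis
      by (intro exI[of _ "\<lambda>i. c i + c' i"]) (simp add: tr sum.distrib distrib_right)
  qed
qed

text \<open>Permutation matrices of left multiplication, in an enumeration \<open>e\<close> of the
  group. The trace counts the \<open>i\<close> with \<open>e i = x \<otimes> e i\<close>, which
  exist only when \<open>x\<close> is the identity.\<close>

lemma regular_representation:
  obtains R where "group_rep H N R"
    "\<And>x. x \<in> carrier H \<Longrightarrow> tr (R x) = (if x = \<one> then of_nat N else 0)"
proof -
  obtain e where e: "bij_betw e {..<N} (carrier H)"
    using ex_bij_betw_nat_finite[OF finite_carrier] by (auto simp: atLeast0LessThan)
  have ec: "e i \<in> carrier H" if "i < N" for i using e that by (auto simp: bij_betw_def)
  have einj: "e i = e j \<longleftrightarrow> i = j" if "i < N" "j < N" for i j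
    using e that by (auto simp: bij_betw_def inj_on_def)
  define R :: "'a \<Rightarrow> complex mat"
    where "R x = mat N N (\<lambda>(i, j). if e i = x \<otimes> e j then 1 else 0)" for x
  have "group_rep H N R"
    unfolding group_rep_def
  proof (intro conjI ballI)
    show "R \<one> = 1\<^sub>m N" by (rule eq_matI) (auto simp: R_def ec einj)
    fix x y assume xy: "x \<in> carrier H" "y \<in> carrier H"
    show "R (x \<otimes> y) = R x * R y"
    proof (rule eq_matI)
      fix i j assume "i < dim_row (R x * R y)" "j < dim_col (R x * R y)"
      then have ij: "i < N" "j < N" by (auto simp: R_def)
      have "(R x * R y) $$ (i, j) = (\<Sum>l<N. R x $$ (i, l) * R y $$ (l, j))"
        by (rule index_mult_mat_sum) (use ij in \<open>auto simp: R_def\<close>)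
      also have "\<dots> = (\<Sum>l<N. (\<lambda>k. if k = y \<otimes> e j then if e i = x \<otimes> k then 1 else 0 else 0) (e l))"
        using ij by (intro sum.cong) (auto simp: R_def)
      also have "\<dots> = (\<Sum>k\<in>carrier H. if k = y \<otimes> e j then if e i = x \<otimes> k then 1 else 0 else 0)"
        by (rule sum.reindex_bij_betw[OF e])
      also have "\<dots> = R (x \<otimes> y) $$ (i, j)"
        using ij xy ec by (simp add: finite_carrier R_def m_assoc)
      finally show "R (x \<otimes> y) $$ (i, j) = (R x * R y) $$ (i, j)" by simp
    qed (auto simp: R_def)
  qed (simp add: R_def)
  moreover have "tr (R x) = (if x = \<one> then of_nat N else 0)" if x: "x \<in> carrier H" for x
  proof -
    have "tr (R x) = (\<Sum>i<N. if e i = x \<otimes> e i then 1 else 0)" by (simp add: tr_def R_def)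
    also have "\<dots> = (\<Sum>i<N. if x = \<one> then 1 else 0)"
      using x ec by (intro sum.cong) auto
    finally show ?thesis by simp
  qed
  ultimately show ?thesis using that by blast
qed

theorem sum_of_squares_of_degrees:
  fixes \<Lambda> :: "'i \<Rightarrow> 'a \<Rightarrow> complex mat"
  assumes fin: "finite I"
    and rep: "\<And>i. i \<in> I \<Longrightarrow> group_rep H (d i) (\<Lambda> i)"
    and irr: "\<And>i. i \<in> I \<Longrightarrow> irreducible_on (carrier H) (d i) (\<Lambda> i)"
    and ineq: "\<And>i j. i \<in> I \<Longrightarrow> j \<in> I \<Longrightarrow> i \<noteq> j \<Longrightarrow>
      \<not> (d i = d j \<and> equivalent_representations (carrier H) (d i) (\<Lambda> i) (\<Lambda> j))"
    and exh: "\<And>m \<rho>. group_rep H m \<rho> \<Longrightarrow> irreducible_on (carrier H) m \<rho> \<Longrightarrow>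
      \<exists>i\<in>I. d i = m \<and> equivalent_representations (carrier H) m (\<Lambda> i) \<rho>"
  shows "(\<Sum>i\<in>I. (d i)\<^sup>2) = card (carrier H)"
proof -
  obtain R where R: "group_rep H N R"
    "\<And>x. x \<in> carrier H \<Longrightarrow> tr (R x) = (if x = \<one> then of_nat N else 0)"
    using regular_representation by blast
  \<comment> \<open>Equivalent representations have the same character, so every irreducible
    character occurs among those of the \<open>\<Lambda> i\<close>.\<close>
  have exh': "\<exists>i\<in>I. \<forall>x\<in>carrier H. tr (\<rho> x) = tr (\<Lambda> i x)"
    if "group_rep H m \<rho>" "irreducible_on (carrier H) m \<rho>" for m \<rho>
  proof -
    from exh[OF that] obtain i where i: "i \<in> I" "d i = m"
      and "equivalent_representations (carrier H) m (\<Lambda> i) \<rho>" by blast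
    then obtain T S where T: "T \<in> carrier_mat m m" "S \<in> carrier_mat m m" "S * T = 1\<^sub>m m"
      and eq: "\<And>x. x \<in> carrier H \<Longrightarrow> \<rho> x = T * \<Lambda> i x * S"
      unfolding equivalent_representations_def general_linear_def by blast
    have "tr (\<rho> x) = tr (\<Lambda> i x)" if x: "x \<in> carrier H" for x
      using tr_similar[OF _ T] group_repD(1)[OF rep[OF i(1)] x] i by (simp add: eq[OF x])
    then show ?thesis using i by blast
  qed
  have "\<exists>c :: 'i \<Rightarrow> nat. \<forall>x\<in>carrier H. tr (R x) = (\<Sum>i\<in>I. of_nat (c i) * tr (\<Lambda> i x))"
    by (rule character_decomposition[OF _ fin R(1)]) (rule exh')
  then obtain c :: "'i \<Rightarrow> nat"
    where c: "\<And>x. x \<in> carrier H \<Longrightarrow> tr (R x) = (\<Sum>i\<in>I. of_nat (c i) * tr (\<Lambda> i x))" by blast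
  have deg: "tr (\<Lambda> i \<one>) = of_nat (d i)" if "i \<in> I" for i
    by (simp add: group_repD(2)[OF rep[OF that]] tr_one)
  have cd: "c j = d j" if j: "j \<in> I" for j
  proof -
    \<comment> \<open>The pairing of the characters of \<open>R\<close> and
      \<open>\<Lambda> j\<close> is evaluated twice. The trace of \<open>R\<close> is supported at
      the identity, which gives \<open>N * d j\<close>; expanding it by \<open>c\<close> and using
      orthogonality gives \<open>c j * N\<close>.\<close>
    have "of_nat N * of_nat (d j) = (\<Sum>x\<in>carrier H. if x = \<one> then of_nat N * tr (\<Lambda> j (inv x)) else 0)"
      using finite_carrier by (simp add: deg[OF j])
    also have "\<dots> = (\<Sum>x\<in>carrier H. tr (R x) * tr (\<Lambda> j (inv x)))"
      by (intro sum.cong) (auto simp: R(2))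
    also have "\<dots> = (\<Sum>x\<in>carrier H. \<Sum>i\<in>I. of_nat (c i) * (tr (\<Lambda> i x) * tr (\<Lambda> j (inv x))))"
      by (intro sum.cong) (auto simp: c sum_distrib_right mult.assoc)
    also have "\<dots> = (\<Sum>i\<in>I. \<Sum>x\<in>carrier H. of_nat (c i) * (tr (\<Lambda> i x) * tr (\<Lambda> j (inv x))))"
      by (rule sum.swap)
    also have "\<dots> = (\<Sum>i\<in>I. of_nat (c i) * (\<Sum>x\<in>carrier H. tr (\<Lambda> i x) * tr (\<Lambda> j (inv x))))"
      by (simp add: sum_distrib_left)
    also have "\<dots> = (\<Sum>i\<in>I. if i = j then of_nat (c i) * of_nat N else 0)"
    proof (rule sum.cong[OF refl])
      fix i assume i: "i \<in> I"
      show "of_nat (c i) * (\<Sum>x\<in>carrier H. tr (\<Lambda> i x) * tr (\<Lambda> j (inv x))) =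
          (if i = j then of_nat (c i) * of_nat N else 0)"
      proof (cases "i = j")
        case True
        then show ?thesis using character_orthogonality_same[OF rep[OF i] irr[OF i]] by simp
      next
        case False
        \<comment> \<open>Orthogonality speaks of an equivalence from \<open>\<Lambda> j\<close> to
          \<open>\<Lambda> i\<close>, so \<open>ineq\<close> is applied with the indices
          exchanged.\<close>
        have "\<not> (d i = d j \<and> equivalent_representations (carrier H) (d i) (\<Lambda> j) (\<Lambda> i))"
          using ineq[OF j i] False by auto
        from character_orthogonality_inequivalent[OF rep[OF i] irr[OF i] rep[OF j] irr[OF j] this]
        show ?thesis using False by simp
      qed
    qed
    also have "\<dots> = of_nat (c j) * of_nat N" using fin j by simp
    finally have "of_nat (N * d j) = (of_nat (c j * N) :: complex)" by simp
    then show ?thesis using N_pos by (simp only: of_nat_eq_iff) simp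
  qed
  have "of_nat N = (\<Sum>i\<in>I. of_nat (c i) * tr (\<Lambda> i \<one>))" using R(2)[of \<one>] c[of \<one>] by simp
  also have "\<dots> = (\<Sum>i\<in>I. of_nat ((d i)\<^sup>2))"
    by (intro sum.cong) (auto simp: cd deg power2_eq_square)
  finally have "of_nat N = (of_nat (\<Sum>i\<in>I. (d i)\<^sup>2) :: complex)" by simp
  then show ?thesis by (simp only: of_nat_eq_iff)
qed

section \<open>Sums over commutators and divisibility of the group order\<close>

text \<open>Expanding the triple product into entries leaves sums over \<open>h\<close> that
  \<open>orthogonality_same\<close> evaluates; the sum over all conjugates thus acts as a
  scalar.\<close>

lemma sum_conjugates:
  assumes \<rho>: "group_rep H m \<rho>" "irreducible_on (carrier H) m \<rho>"
    and g: "g \<in> carrier H" and ij: "i < m" "j < m"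
  shows "(\<Sum>h\<in>carrier H. \<rho> (h \<otimes> g \<otimes> inv h) $$ (i, j)) =
    (if i = j then of_nat N / of_nat m * tr (\<rho> g) else 0)"
proof -
  note [simp] = group_repD(1)[OF \<rho>(1)]
  have "(\<Sum>h\<in>carrier H. \<rho> (h \<otimes> g \<otimes> inv h) $$ (i, j)) =
      (\<Sum>h\<in>carrier H. \<Sum>b<m. \<Sum>a<m. \<rho> g $$ (a, b) * (\<rho> h $$ (i, a) * \<rho> (inv h) $$ (b, j)))"
  proof (rule sum.cong[OF refl])
    fix h assume h: "h \<in> carrier H"
    have "\<rho> (h \<otimes> g \<otimes> inv h) = \<rho> h * \<rho> g * \<rho> (inv h)"
      using g h by (simp add: group_repD(3)[OF \<rho>(1)])
    also have "\<dots> $$ (i, j) = (\<Sum>b<m. (\<rho> h * \<rho> g) $$ (i, b) * \<rho> (inv h) $$ (b, j))"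
      by (rule index_mult_mat_sum[of _ m m _ m]) (use g h ij in auto)
    also have "\<dots> = (\<Sum>b<m. (\<Sum>a<m. \<rho> h $$ (i, a) * \<rho> g $$ (a, b)) * \<rho> (inv h) $$ (b, j))"
      using g h ij by (simp add: index_mult_mat_sum[of _ m m _ m] del: index_mult_mat(1))
    finally show "\<rho> (h \<otimes> g \<otimes> inv h) $$ (i, j) =
        (\<Sum>b<m. \<Sum>a<m. \<rho> g $$ (a, b) * (\<rho> h $$ (i, a) * \<rho> (inv h) $$ (b, j)))"
      by (simp add: sum_distrib_left sum_distrib_right mult_ac)
  qed
  also have "\<dots> = (\<Sum>b<m. \<Sum>h\<in>carrier H. \<Sum>a<m. \<rho> g $$ (a, b) * (\<rho> h $$ (i, a) * \<rho> (inv h) $$ (b, j)))"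
    by (rule sum.swap)
  also have "\<dots> = (\<Sum>b<m. \<Sum>a<m. \<Sum>h\<in>carrier H. \<rho> g $$ (a, b) * (\<rho> h $$ (i, a) * \<rho> (inv h) $$ (b, j)))"
    by (intro sum.cong refl sum.swap)
  also have "\<dots> = (\<Sum>b<m. \<Sum>a<m. if a = b then (if i = j then \<rho> g $$ (b, b) * (of_nat N / of_nat m) else 0) else 0)"
    using orthogonality_same[OF \<rho>] ij
    by (intro sum.cong refl) (auto simp: sum_distrib_left[symmetric])
  also have "\<dots> = (if i = j then of_nat N / of_nat m * tr (\<rho> g) else 0)"
    using tr_carrier[OF group_repD(1)[OF \<rho>(1) g]] by (simp add: sum_distrib_left mult.commute)
  finally show ?thesis .
qed

text \<open>The commutator is grouped as \<open>g\<close> times a conjugate of \<open>inv g\<close>.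
  The sum over \<open>h\<close> is then the scalar of \<open>sum_conjugates\<close>, and the
  remaining sum of \<open>\<rho> g\<close> times \<open>tr (\<rho> (inv g))\<close> yields a second
  factor \<open>N / m\<close>. The extra \<open>x\<close> prepares the eigenvector equation in
  \<open>degree_dvd_order\<close>.\<close>

lemma sum_commutators:
  assumes \<rho>: "group_rep H m \<rho>" "irreducible_on (carrier H) m \<rho>" and x: "x \<in> carrier H" and i: "i < m"
  shows "(\<Sum>g\<in>carrier H. \<Sum>h\<in>carrier H. \<rho> (g \<otimes> (h \<otimes> inv g \<otimes> inv h) \<otimes> x) $$ (i, i)) =
    (of_nat N / of_nat m)\<^sup>2 * \<rho> x $$ (i, i)"
proof -
  note [simp] = group_repD(1)[OF \<rho>(1)]
  let ?q = "of_nat N / of_nat m :: complex"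
  have 1: "(\<Sum>h\<in>carrier H. \<rho> (g \<otimes> (h \<otimes> inv g \<otimes> inv h) \<otimes> x) $$ (i, i)) =
      (\<Sum>b<m. \<Sum>l<m. ?q * \<rho> x $$ (b, i) * (\<rho> g $$ (i, b) * \<rho> (inv g) $$ (l, l)))"
    if g: "g \<in> carrier H" for g
  proof -
    have "(\<Sum>h\<in>carrier H. \<rho> (g \<otimes> (h \<otimes> inv g \<otimes> inv h) \<otimes> x) $$ (i, i)) =
      (\<Sum>h\<in>carrier H. \<Sum>b<m. \<Sum>a<m. \<rho> x $$ (b, i) * (\<rho> g $$ (i, a) * \<rho> (h \<otimes> inv g \<otimes> inv h) $$ (a, b)))"
    proof (rule sum.cong[OF refl])
      fix h assume h: "h \<in> carrier H"
      let ?c = "h \<otimes> inv g \<otimes> inv h"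
      have "\<rho> (g \<otimes> ?c \<otimes> x) = \<rho> g * \<rho> ?c * \<rho> x"
        using g h x by (simp add: group_repD(3)[OF \<rho>(1)] del: m_assoc)
      also have "\<dots> $$ (i, i) = (\<Sum>b<m. (\<rho> g * \<rho> ?c) $$ (i, b) * \<rho> x $$ (b, i))"
        by (rule index_mult_mat_sum[of _ m m _ m]) (use g h x i in auto)
      also have "\<dots> = (\<Sum>b<m. (\<Sum>a<m. \<rho> g $$ (i, a) * \<rho> ?c $$ (a, b)) * \<rho> x $$ (b, i))"
        using g h i by (simp add: index_mult_mat_sum[of _ m m _ m] del: index_mult_mat(1))
      finally show "\<rho> (g \<otimes> ?c \<otimes> x) $$ (i, i) =
          (\<Sum>b<m. \<Sum>a<m. \<rho> x $$ (b, i) * (\<rho> g $$ (i, a) * \<rho> ?c $$ (a, b)))"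
        by (simp add: sum_distrib_left sum_distrib_right mult_ac)
    qed
    also have "\<dots> = (\<Sum>b<m. \<Sum>h\<in>carrier H. \<Sum>a<m. \<rho> x $$ (b, i) * (\<rho> g $$ (i, a) * \<rho> (h \<otimes> inv g \<otimes> inv h) $$ (a, b)))"
      by (rule sum.swap)
    also have "\<dots> = (\<Sum>b<m. \<Sum>a<m. \<Sum>h\<in>carrier H. \<rho> x $$ (b, i) * (\<rho> g $$ (i, a) * \<rho> (h \<otimes> inv g \<otimes> inv h) $$ (a, b)))"
      by (intro sum.cong refl sum.swap)
    also have "\<dots> = (\<Sum>b<m. \<Sum>a<m. if a = b then \<rho> x $$ (b, i) * (\<rho> g $$ (i, b) * (?q * tr (\<rho> (inv g)))) else 0)"
    proof (intro sum.cong refl)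
      fix a b assume ab: "a \<in> {..<m}" "b \<in> {..<m}"
      show "(\<Sum>h\<in>carrier H. \<rho> x $$ (b, i) * (\<rho> g $$ (i, a) * \<rho> (h \<otimes> inv g \<otimes> inv h) $$ (a, b))) =
          (if a = b then \<rho> x $$ (b, i) * (\<rho> g $$ (i, b) * (?q * tr (\<rho> (inv g)))) else 0)"
        unfolding sum_distrib_left[symmetric]
        using sum_conjugates[OF \<rho>, of "inv g" a b] ab g by simp
    qed
    also have "\<dots> = (\<Sum>b<m. \<rho> x $$ (b, i) * (\<rho> g $$ (i, b) * (?q * (\<Sum>l<m. \<rho> (inv g) $$ (l, l)))))"
      using tr_carrier[OF group_repD(1)[OF \<rho>(1), of "inv g"]] g by simp
    finally show ?thesis by (simp only: sum_distrib_left mult_ac)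
  qed
  have "(\<Sum>g\<in>carrier H. \<Sum>h\<in>carrier H. \<rho> (g \<otimes> (h \<otimes> inv g \<otimes> inv h) \<otimes> x) $$ (i, i)) =
    (\<Sum>g\<in>carrier H. \<Sum>b<m. \<Sum>l<m. ?q * \<rho> x $$ (b, i) * (\<rho> g $$ (i, b) * \<rho> (inv g) $$ (l, l)))"
    using 1 by (intro sum.cong) auto
  also have "\<dots> = (\<Sum>b<m. \<Sum>g\<in>carrier H. \<Sum>l<m. ?q * \<rho> x $$ (b, i) * (\<rho> g $$ (i, b) * \<rho> (inv g) $$ (l, l)))"
    by (rule sum.swap)
  also have "\<dots> = (\<Sum>b<m. \<Sum>l<m. \<Sum>g\<in>carrier H. ?q * \<rho> x $$ (b, i) * (\<rho> g $$ (i, b) * \<rho> (inv g) $$ (l, l)))"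
    by (intro sum.cong refl sum.swap)
  also have "\<dots> = (\<Sum>b<m. \<Sum>l<m. if l = b then if b = i then ?q * \<rho> x $$ (b, i) * ?q else 0 else 0)"
  proof (intro sum.cong refl)
    fix b l assume bl: "b \<in> {..<m}" "l \<in> {..<m}"
    show "(\<Sum>g\<in>carrier H. ?q * \<rho> x $$ (b, i) * (\<rho> g $$ (i, b) * \<rho> (inv g) $$ (l, l))) =
        (if l = b then if b = i then ?q * \<rho> x $$ (b, i) * ?q else 0 else 0)"
      unfolding sum_distrib_left[symmetric]
      using orthogonality_same[OF \<rho>, of b l i l] bl i by auto
  qed
  also have "\<dots> = ?q\<^sup>2 * \<rho> x $$ (i, i)"
    using i by (simp add: power2_eq_square mult_ac)
  finally show ?thesis .
qed

end

text \<open>The characteristic polynomial of an integer matrix is monic with integer coefficients,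
  and \<open>q\<close> is a root of it.\<close>

lemma algebraic_int_eigenvalue:
  fixes M :: "int mat" and v :: "complex vec"
  assumes M: "M \<in> carrier_mat n n" and v: "v \<in> carrier_vec n" "v \<noteq> 0\<^sub>v n"
    and ev: "map_mat of_int M *\<^sub>v v = q \<cdot>\<^sub>v v"
  shows "algebraic_int q"
proof -
  let ?M = "map_mat of_int M :: complex mat"
  have M': "?M \<in> carrier_mat n n" using M by simp
  have "eigenvalue ?M q" unfolding eigenvalue_def eigenvector_def using v ev M by auto
  then have "poly (char_poly ?M) q = 0" using eigenvalue_root_char_poly[OF M'] by simp
  moreover have "lead_coeff (char_poly ?M) = 1" using degree_monic_char_poly[OF M'] by simp
  moreover have "coeff (char_poly ?M) i \<in> \<int>" for i
    unfolding of_int_hom.char_poly_hom[OF M] by simp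
  ultimately show ?thesis by (intro algebraic_int.intros) auto
qed

context finite_group
begin

theorem degree_dvd_order:
  assumes \<rho>: "group_rep H m \<rho>" "irreducible_on (carrier H) m \<rho>"
  shows "m dvd card (carrier H)"
proof -
  have m: "m \<ge> 1" using \<rho>(2) by (simp add: irreducible_on_def)
  obtain e where e: "bij_betw e {..<N} (carrier H)"
    using ex_bij_betw_nat_finite[OF finite_carrier] by (auto simp: atLeast0LessThan)
  have ec: "e i \<in> carrier H" if "i < N" for i using e that by (auto simp: bij_betw_def)
  define C where "C = (\<lambda>(g, h). g \<otimes> (h \<otimes> inv g \<otimes> inv h))"
  let ?HH = "carrier H \<times> carrier H"
  have Cc: "C p \<in> carrier H" if "p \<in> ?HH" for p using that by (auto simp: C_def)
  \<comment> \<open>Applying \<open>M\<close> to a function on the group sums that function over all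
    \<open>C p \<otimes> e i\<close>. The function chosen is the coefficient \<open>(0, 0)\<close>
    of \<open>\<rho>\<close>, which exists because \<open>m \<ge> 1\<close> and is nonzero because
    its value at the identity is 1.\<close>
  define M where "M = mat N N (\<lambda>(i, j). int (card {p \<in> ?HH. C p \<otimes> e i = e j}))"
  define v where "v = vec N (\<lambda>j. \<rho> (e j) $$ (0, 0))"
  let ?q = "(of_nat N / of_nat m)\<^sup>2 :: complex"
  have M: "M \<in> carrier_mat N N" and v: "v \<in> carrier_vec N" by (simp_all add: M_def v_def)
  have "v \<noteq> 0\<^sub>v N"
  proof
    assume v0: "v = 0\<^sub>v N"
    obtain j where "j < N" "e j = \<one>" using e by (metis (no_types, lifting) bij_betw_iff_bijections lessThan_iff one_closed)
    then have "v $ j = 1" using m by (simp add: v_def group_repD(2)[OF \<rho>(1)])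
    then show False using v0 \<open>j < N\<close> by simp
  qed
  moreover have "map_mat of_int M *\<^sub>v v = ?q \<cdot>\<^sub>v v"
  proof (rule eq_vecI)
    fix i assume "i < dim_vec (?q \<cdot>\<^sub>v v)"
    then have i: "i < N" by (simp add: v_def)
    have "(map_mat of_int M *\<^sub>v v) $ i = (\<Sum>j<N. map_mat of_int M $$ (i, j) * v $ j)"
      by (rule index_mult_mat_vec_sum[OF _ v i]) (use M in simp)
    also have "\<dots> = (\<Sum>j<N. \<Sum>p\<in>?HH. if C p \<otimes> e i = e j then \<rho> (e j) $$ (0, 0) else 0)"
      using i finite_carrier
      by (intro sum.cong) (auto simp: M_def v_def sum.If_cases Int_def)
    also have "\<dots> = (\<Sum>p\<in>?HH. \<Sum>j<N. if C p \<otimes> e i = e j then \<rho> (e j) $$ (0, 0) else 0)"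
      by (rule sum.swap)
    also have "\<dots> = (\<Sum>p\<in>?HH. \<rho> (C p \<otimes> e i) $$ (0, 0))"
    proof (rule sum.cong[OF refl])
      fix p assume p: "p \<in> ?HH"
      have "(\<Sum>j<N. if C p \<otimes> e i = e j then \<rho> (e j) $$ (0, 0) else 0) =
          (\<Sum>x\<in>carrier H. if C p \<otimes> e i = x then \<rho> x $$ (0, 0) else 0)"
        by (rule sum.reindex_bij_betw[OF e])
      also have "\<dots> = \<rho> (C p \<otimes> e i) $$ (0, 0)"
        using Cc[OF p] ec[OF i] finite_carrier by simp
      finally show "(\<Sum>j<N. if C p \<otimes> e i = e j then \<rho> (e j) $$ (0, 0) else 0) =
        \<rho> (C p \<otimes> e i) $$ (0, 0)" .
    qed
    also have "\<dots> = (\<Sum>g\<in>carrier H. \<Sum>h\<in>carrier H. \<rho> (g \<otimes> (h \<otimes> inv g \<otimes> inv h) \<otimes> e i) $$ (0, 0))"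
      by (simp add: sum.cartesian_product C_def case_prod_beta)
    also have "\<dots> = ?q * \<rho> (e i) $$ (0, 0)"
      by (rule sum_commutators[OF \<rho> ec[OF i]]) (use m in simp)
    finally show "(map_mat of_int M *\<^sub>v v) $ i = (?q \<cdot>\<^sub>v v) $ i" using i by (simp add: v_def)
  qed (use M in \<open>simp add: v_def\<close>)
  ultimately have "algebraic_int ?q" using algebraic_int_eigenvalue[OF M v] by blast
  \<comment> \<open>A rational algebraic integer is an integer, so \<open>m^2\<close> divides
    \<open>N^2\<close>, and therefore \<open>m\<close> divides \<open>N\<close>.\<close>
  moreover have "?q \<in> \<rat>" by (intro Rats_power Rats_divide) auto
  ultimately have "?q \<in> \<int>" by (rule rational_algebraic_int_is_int)
  then obtain z where "?q = of_int z" by (auto elim: Ints_cases)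
  then have "(of_int (int (N\<^sup>2)) :: complex) = of_int (z * int (m\<^sup>2))"
    using m by (simp add: field_simps power_divide)
  then have "int (N\<^sup>2) = z * int (m\<^sup>2)" by (simp only: of_int_eq_iff)
  then have "int (m\<^sup>2) dvd int (N\<^sup>2)" by simp
  then have "m\<^sup>2 dvd N\<^sup>2" by (simp only: int_dvd_int_iff)
  then show ?thesis by (simp add: pow_divides_pow_iff)
qed

end

section \<open>The Post covering group\<close>

context nary_group
begin

text \<open>Evaluation from the left end: each step replaces the first \<open>n\<close> letters by
  one, so \<open>k\<close> steps reduce a word of length \<open>k * (n - 1) + 1\<close> to a single
  letter, which \<open>hd\<close> returns.\<close>

primrec iterate_op :: "nat \<Rightarrow> 'a list \<Rightarrow> 'a" where
  "iterate_op 0 xs = hd xs"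
| "iterate_op (Suc k) xs = iterate_op k (f (take n xs) # drop n xs)"

lemma iterate_op_closed:
  "length xs = k * (n - 1) + 1 \<Longrightarrow> set xs \<subseteq> G \<Longrightarrow> iterate_op k xs \<in> G"
proof (induction k arbitrary: xs)
  case 0
  then show ?case by (cases xs) auto
next
  case (Suc k)
  have "f (take n xs) \<in> G"
    using Suc.prems arity by (intro closed) (auto dest!: in_set_takeD)
  then show ?case
    using Suc.prems arity by (auto intro!: Suc.IH dest!: in_set_dropD)
qed

text \<open>Induction on the number of steps, with \<open>assoc\<close> called when the block
  \<open>w\<close> overlaps the first \<open>n\<close> letters. This frees long products from the
  fixed order of evaluation.\<close>

lemma iterate_op_reduce:
  assumes "length w = n" "set w \<subseteq> G"
  shows "length (u @ w @ v) = Suc k * (n - 1) + 1 \<Longrightarrow> set u \<subseteq> G \<Longrightarrow> set v \<subseteq> G \<Longrightarrow>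
    iterate_op (Suc k) (u @ w @ v) = iterate_op k (u @ [f w] @ v)"
proof (induction k arbitrary: u v)
  case 0
  then have "u = []" "v = []" using assms(1) arity by auto
  then show ?case using assms by simp
next
  case (Suc k)
  \<comment> \<open>The block is the first one evaluated, or lies beyond the first \<open>n\<close>
    letters and is untouched by the first step, or overlaps them partially.\<close>
  consider "u = []" | "n \<le> length u" | "0 < length u" "length u < n" by fastforce
  then show ?case
  proof cases
    case 1
    then show ?thesis using assms by simp
  next
    case 2
    have "f (take n u) \<in> G"
      using Suc.prems 2 by (intro closed) (auto dest!: in_set_takeD)
    then have "iterate_op (Suc k) ((f (take n u) # drop n u) @ w @ v) =
        iterate_op k ((f (take n u) # drop n u) @ [f w] @ v)"
      using Suc.prems 2 arity by (intro Suc.IH) (auto dest!: in_set_dropD)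
    then show ?thesis using 2 by simp
  next
    case 3
    \<comment> \<open>\<open>v1\<close> fills \<open>u @ w\<close> up to the
      \<open>2 * n - 1\<close> letters on which \<open>assoc\<close> compares the positions 0 and
      \<open>length u\<close>; on both sides these letters become one letter followed by
      \<open>v2\<close>.\<close>
    define v1 v2 where "v1 = take (n - 1 - length u) v" and "v2 = drop (n - 1 - length u) v"
    have v: "v = v1 @ v2" by (simp add: v1_def v2_def)
    have lv: "length v \<ge> n - 1 - length u" using Suc.prems(1) assms(1) by simp
    then have lv1: "length v1 = n - 1 - length u" by (simp add: v1_def)
    define ys where "ys = u @ w @ v1"
    have ys: "length ys = 2 * n - 1" "set ys \<subseteq> G"
      using Suc.prems assms lv1 3 v unfolding ys_def by auto
    have "f (f (take n ys) # drop n ys) = f (u @ [f w] @ v1)"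
      using assoc[OF ys, of 0 "length u"] 3 assms unfolding ys_def by simp
    moreover have "iterate_op (Suc (Suc k)) (u @ w @ v) =
        iterate_op k (f (f (take n ys) # drop n ys) # v2)"
    proof -
      define zs where "zs = f (take n ys) # drop n ys"
      have zs: "length zs = n" using ys arity by (simp add: zs_def)
      have "iterate_op (Suc (Suc k)) (u @ w @ v) = iterate_op (Suc k) (zs @ v2)"
        using ys by (simp add: zs_def ys_def v)
      also have "\<dots> = iterate_op k (f zs # v2)" using zs by simp
      finally show ?thesis by (simp add: zs_def)
    qed
    moreover have "iterate_op (Suc k) (u @ [f w] @ v) = iterate_op k (f (u @ [f w] @ v1) # v2)"
    proof -
      define zs where "zs = u @ [f w] @ v1"
      have "length zs = n" using lv1 3 by (simp add: zs_def)
      then have "iterate_op (Suc k) (zs @ v2) = iterate_op k (f zs # v2)" by simp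
      then show ?thesis by (simp add: zs_def v)
    qed
    ultimately show ?thesis by simp
  qed
qed

text \<open>Words whose length has the form \<open>k * (n - 1) + 1\<close>. The right side is
  \<open>1 mod (n - 1)\<close> because the modulus is 1 when \<open>n = 2\<close>, where every
  nonempty word over \<open>G\<close> qualifies.\<close>

definition good :: "'a list \<Rightarrow> bool" where
  "good xs \<longleftrightarrow> set xs \<subseteq> G \<and> xs \<noteq> [] \<and> length xs mod (n - 1) = 1 mod (n - 1)"

lemma goodD:
  assumes "good xs"
  obtains k where "length xs = k * (n - 1) + 1" "set xs \<subseteq> G"
proof -
  have "length xs \<ge> 1" using assms by (cases xs) (auto simp: good_def)
  then have "n - 1 dvd length xs - 1"
    using assms unfolding good_def by (metis mod_eq_dvd_iff_nat)
  then obtain k where "length xs - 1 = k * (n - 1)" by (metis dvd_def mult.commute)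
  then show ?thesis using that[of k] \<open>length xs \<ge> 1\<close> assms by (auto simp: good_def)
qed

lemma goodI: "length xs = k * (n - 1) + 1 \<Longrightarrow> set xs \<subseteq> G \<Longrightarrow> good xs"
  unfolding good_def by (intro conjI) (auto simp only: mod_mult_self3 list.size)

lemma good_extend:
  assumes "good xs" "length ys = length xs + k * (n - 1)" "set ys \<subseteq> G"
  shows "good ys"
proof -
  have "ys \<noteq> []" using assms by (auto simp: good_def)
  then show ?thesis using assms by (simp add: good_def)
qed

definition long_op :: "'a list \<Rightarrow> 'a" where
  "long_op xs = iterate_op ((length xs - 1) div (n - 1)) xs"

lemma long_op_eq: "length xs = k * (n - 1) + 1 \<Longrightarrow> long_op xs = iterate_op k xs"
  using arity by (simp add: long_op_def)

lemma long_op_closed: "good xs \<Longrightarrow> long_op xs \<in> G"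
  by (metis goodD long_op_eq iterate_op_closed)

lemma long_op_singleton [simp]: "long_op [x] = x"
  by (simp add: long_op_def)

lemma long_op_basic: "length xs = n \<Longrightarrow> long_op xs = f xs"
  using arity long_op_eq[of xs 1] by simp

lemma long_op_reduce:
  assumes "good (u @ w @ v)" "length w = n"
  shows "long_op (u @ w @ v) = long_op (u @ [f w] @ v)"
proof -
  obtain k where k: "length (u @ w @ v) = k * (n - 1) + 1" and G: "set (u @ w @ v) \<subseteq> G"
    using goodD[OF assms(1)] by blast
  have "k \<noteq> 0" using k assms(2) arity by (intro notI) simp
  then obtain j where j: "k = Suc j" using not0_implies_Suc by blast
  have "length (u @ [f w] @ v) = j * (n - 1) + 1" using k assms(2) arity unfolding j by simp
  moreover have "iterate_op (Suc j) (u @ w @ v) = iterate_op j (u @ [f w] @ v)"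
    using k G assms(2) unfolding j by (intro iterate_op_reduce) auto
  ultimately show ?thesis using long_op_eq k j by metis
qed

text \<open>Induction on the number of steps in \<open>w\<close>: its first \<open>n\<close> letters
  are multiplied both inside the context and in \<open>w\<close> alone, each time by
  \<open>long_op_reduce\<close>.\<close>

theorem long_op_assoc:
  assumes "good w" "good (u @ w @ v)"
  shows "long_op (u @ w @ v) = long_op (u @ [long_op w] @ v)"
proof -
  obtain k where "length w = k * (n - 1) + 1" using goodD[OF assms(1)] by blast
  then show ?thesis using assms
  proof (induction k arbitrary: w)
    case 0
    then obtain x where "w = [x]" by (cases w) auto
    then show ?case by simp
  next
    case (Suc k)
    define w1 w2 where "w1 = take n w" and "w2 = drop n w"
    have w: "w = w1 @ w2" by (simp add: w1_def w2_def)
    have l: "length w1 = n" using Suc.prems(1) arity by (simp add: w1_def)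
    have G: "set w \<subseteq> G" "set u \<subseteq> G" "set v \<subseteq> G" using Suc.prems by (auto simp: good_def)
    have l': "length (f w1 # w2) = k * (n - 1) + 1"
      using Suc.prems(1) l arity by (simp add: w)
    have fw1: "f w1 \<in> G" using l G w by (intro closed) auto
    have g1: "good (f w1 # w2)" using goodI[OF l'] fw1 G w by auto
    have "length (u @ w @ v) mod (n - 1) = length (u @ (f w1 # w2) @ v) mod (n - 1)"
    proof -
      have "length (u @ w @ v) = length (u @ (f w1 # w2) @ v) + (n - 1)"
        using Suc.prems(1) l' by simp
      then show ?thesis by (simp only: mod_add_self2)
    qed
    then have g2: "good (u @ (f w1 # w2) @ v)"
      using Suc.prems(3) fw1 G w unfolding good_def by auto
    have "long_op (u @ w @ v) = long_op (u @ [f w1] @ w2 @ v)"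
      using long_op_reduce[of u w1 "w2 @ v"] Suc.prems(3) l by (simp add: w)
    also have "\<dots> = long_op (u @ [long_op (f w1 # w2)] @ v)"
      using Suc.IH[OF l' g1 g2] by simp
    also have "long_op (f w1 # w2) = long_op w"
      using long_op_reduce[of "[]" w1 w2] Suc.prems(2) l by (simp add: w)
    finally show ?case .
  qed
qed

section \<open>Solvability, neutral words and inverses\<close>

lemma solve_f:
  assumes "y \<in> G" "set u \<subseteq> G" "set v \<subseteq> G" "length u + length v = n - 1"
  obtains s where "s \<in> G" "f (u @ s # v) = y"
proof -
  \<comment> \<open>The \<open>y\<close> in the list is a placeholder at position
    \<open>length u\<close>, overwritten by the unknown \<open>z\<close>.\<close>
  have "\<exists>!z. z \<in> G \<and> f ((u @ y # v)[length u := z]) = y"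
    using assms arity by (intro solvable) auto
  then show ?thesis using that by (auto simp: list_update_append)
qed

lemma cancel_f:
  assumes "set u \<subseteq> G" "set v \<subseteq> G" "length u + length v = n - 1" "s \<in> G" "t \<in> G"
    and "f (u @ s # v) = f (u @ t # v)"
  shows "s = t"
proof -
  have "\<exists>!z. z \<in> G \<and> f ((u @ s # v)[length u := z]) = f (u @ s # v)"
    using assms arity by (intro solvable closed) auto
  moreover have "(u @ s # v)[length u := z] = u @ z # v" for z by (simp add: list_update_append)
  ultimately show ?thesis using assms by metis
qed

definition base :: 'a where "base = (SOME a. a \<in> G)"

lemma base_closed [simp]: "base \<in> G"
  unfolding base_def using nonempty by (simp add: some_in_eq)

text \<open>Fixing one letter \<open>a\<close> from the left has global consequences: solvability
  writes every letter as a product beginning with \<open>a\<close>, cancellation carries the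
  property to the right side of a letter, and in a good context \<open>E\<close> always has a
  neighbouring letter.\<close>

lemma neutral_word:
  assumes E: "set E \<subseteq> G" "length E = 2 * (n - 1)" and a: "a \<in> G" "long_op (E @ [a]) = a"
    and uv: "good (u @ v)"
  shows "long_op (u @ E @ v) = long_op (u @ v)"
proof -
  have gE: "good (E @ [y])" "good (y # E)" if "y \<in> G" for y
    using E that by (auto intro!: goodI[where k = 2])
  have gEt: "good (E @ y # t)" "good (y # E @ t)" if "y \<in> G" "set t \<subseteq> G" "length t = n - 1" for y t
    using E that by (auto intro!: goodI[where k = 3])
  have left: "long_op (E @ [y]) = y" if y: "y \<in> G" for y
  proof -
    define t where "t = replicate (n - 2) base"
    obtain s where s: "s \<in> G" "f ([a] @ s # t) = y"
      by (rule solve_f[OF y, of "[a]" t]) (use a arity in \<open>auto simp: t_def\<close>)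
    have t: "set (s # t) \<subseteq> G" "length (s # t) = n - 1" using s arity by (auto simp: t_def)
    have "long_op (E @ [y]) = long_op (E @ [long_op (a # s # t)] @ [])"
      using s t arity by (simp add: long_op_basic)
    also have "\<dots> = long_op (E @ (a # s # t) @ [])"
    proof (rule long_op_assoc[symmetric])
      show "good (a # s # t)" using a t by (intro goodI[where k = 1]) auto
    qed (use gEt(1)[OF a(1) t] in simp)
    also have "\<dots> = long_op ([] @ (E @ [a]) @ (s # t))" by simp
    also have "\<dots> = long_op ([] @ [long_op (E @ [a])] @ (s # t))"
      using gEt(1)[OF a(1) t] gE(1)[OF a(1)] by (intro long_op_assoc) auto
    also have "\<dots> = y" using s t a arity by (simp add: long_op_basic)
    finally show ?thesis .
  qed
  have right: "long_op (y # E) = y" if y: "y \<in> G" for y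
  proof -
    define t where "t = replicate (n - 2) base"
    have t: "set (base # t) \<subseteq> G" "length (base # t) = n - 1" using arity by (auto simp: t_def)
    \<comment> \<open>Followed by \<open>base # t\<close>, the letter \<open>y\<close> and the
      product of \<open>y # E\<close> give the same value, because \<open>E\<close> fixes
      \<open>base\<close> from the left; \<open>cancel_f\<close> removes the common tail.\<close>
    have "f ([] @ long_op (y # E) # base # t) = long_op ([] @ [long_op (y # E)] @ (base # t))"
      using t arity by (simp add: long_op_basic)
    also have "\<dots> = long_op ([] @ (y # E) @ (base # t))"
      using gEt(2)[OF y t] gE(2)[OF y] by (intro long_op_assoc[symmetric]) auto
    also have "\<dots> = long_op ([y] @ (E @ [base]) @ t)" by simp
    also have "\<dots> = long_op ([y] @ [long_op (E @ [base])] @ t)"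
      using gEt(2)[OF y t] gE(1) by (intro long_op_assoc) auto
    also have "\<dots> = f ([] @ y # base # t)" using t arity by (simp add: left long_op_basic)
    finally have "f ([] @ long_op (y # E) # base # t) = f ([] @ y # base # t)" .
    then show ?thesis
      by (rule cancel_f[OF _ t(1) _ long_op_closed[OF gE(2)[OF y]] y, rotated 2]) (use t(2) in simp_all)
  qed
  have guv: "good (u @ E @ v)"
    by (rule good_extend[OF uv, where k = 2]) (use uv E in \<open>auto simp: good_def\<close>)
  show ?thesis
  proof (cases v)
    case (Cons y v')
    have y: "y \<in> G" using uv Cons by (auto simp: good_def)
    have "long_op (u @ (E @ [y]) @ v') = long_op (u @ [long_op (E @ [y])] @ v')"
      using guv gE(1)[OF y] Cons by (intro long_op_assoc) auto
    then show ?thesis using left[OF y] Cons by simp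
  next
    case Nil
    with uv obtain u' y where u: "u = u' @ [y]" by (cases u rule: rev_cases) (auto simp: good_def)
    have y: "y \<in> G" using uv u by (auto simp: good_def)
    have "long_op (u' @ (y # E) @ v) = long_op (u' @ [long_op (y # E)] @ v)"
      using guv gE(2)[OF y] u by (intro long_op_assoc) auto
    then show ?thesis using right[OF y] u by simp
  qed
qed

text \<open>A neutral word beginning with \<open>x\<close> is constructed. Its length
  \<open>2 * (n - 1)\<close> leaves room for \<open>x\<close> and a solved letter \<open>z\<close>
  even when \<open>n = 2\<close>, where \<open>r\<close> is empty.\<close>

lemma right_inverse_letter:
  assumes x: "x \<in> G"
  obtains b where "set b \<subseteq> G" "length (x # b) = 2 * (n - 1)"
    "\<And>u v. good (u @ v) \<Longrightarrow> long_op (u @ (x # b) @ v) = long_op (u @ v)"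
proof -
  define r where "r = replicate (n - 2) x"
  have r: "set r \<subseteq> G" "length r = n - 2" using x by (auto simp: r_def)
  \<comment> \<open>Two equations solved backwards: \<open>s\<close> is chosen so that
    \<open>n - 1\<close> copies of \<open>x\<close> followed by \<open>s\<close> give
    \<open>base\<close>, and \<open>z\<close> so that \<open>r @ [z, base]\<close> gives
    \<open>s\<close>. Together they make \<open>E\<close> fix \<open>base\<close>.\<close>
  obtain s where s: "s \<in> G" "f ((x # r) @ s # []) = base"
    by (rule solve_f[OF base_closed, of "x # r" "[]"]) (use x r arity in auto)
  obtain z where z: "z \<in> G" "f (r @ z # [base]) = s"
    by (rule solve_f[OF s(1), of r "[base]"]) (use r arity in auto)
  define E where "E = x # (r @ r @ [z])"
  have E: "set E \<subseteq> G" "length E = 2 * (n - 1)" using x r z arity by (auto simp: E_def)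
  have "long_op (E @ [base]) = long_op ((x # r) @ (r @ [z, base]) @ [])" by (simp add: E_def)
  also have "\<dots> = long_op ((x # r) @ [f (r @ [z, base])] @ [])"
    using x r z arity by (intro long_op_reduce goodI[where k = 2]) auto
  also have "\<dots> = base" using z s r arity by (simp add: long_op_basic)
  finally have "long_op (E @ [base]) = base" .
  from neutral_word[OF E base_closed this] show ?thesis
    using that[of "r @ r @ [z]"] E unfolding E_def by simp
qed

text \<open>As in a group, the inverse of \<open>x # w\<close> is the inverse of \<open>w\<close>
  followed by that of \<open>x\<close>. Divisibility of the length keeps every context good.\<close>

lemma right_inverse_word:
  assumes "set w \<subseteq> G"
  shows "\<exists>b. set b \<subseteq> G \<and> (n - 1) dvd length (w @ b) \<and>
    (\<forall>u v. good (u @ v) \<longrightarrow> long_op (u @ (w @ b) @ v) = long_op (u @ v))"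
  using assms
proof (induction w)
  case Nil
  then show ?case by (intro exI[of _ "[]"]) auto
next
  case (Cons x w)
  then obtain b where b: "set b \<subseteq> G" "(n - 1) dvd length (w @ b)"
    "\<And>u v. good (u @ v) \<Longrightarrow> long_op (u @ (w @ b) @ v) = long_op (u @ v)" by auto
  obtain c where c: "set c \<subseteq> G" "length (x # c) = 2 * (n - 1)"
    "\<And>u v. good (u @ v) \<Longrightarrow> long_op (u @ (x # c) @ v) = long_op (u @ v)"
    using right_inverse_letter[of x] Cons.prems by auto
  have "long_op (u @ ((x # w) @ b @ c) @ v) = long_op (u @ v)" if uv: "good (u @ v)" for u v
  proof -
    have "length ((u @ [x]) @ (c @ v)) = length (u @ v) + 2 * (n - 1)" using c(2) by simp
    then have "good ((u @ [x]) @ (c @ v))"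
      by (rule good_extend[OF uv]) (use uv c Cons.prems in \<open>auto simp: good_def\<close>)
    from b(3)[OF this] c(3)[OF uv] show ?thesis by simp
  qed
  moreover have "length ((x # w) @ b @ c) = length (w @ b) + length (x # c)" by simp
  then have "(n - 1) dvd length ((x # w) @ b @ c)" using b(2) c(2) by (metis dvd_add dvd_triv_right)
  ultimately show ?case using b c by (intro exI[of _ "b @ c"]) auto
qed

section \<open>Classes of words and the covering group\<close>

text \<open>A residue \<open>r < n - 1\<close> leaves \<open>n - r \<ge> 2\<close> copies of
  \<open>base\<close>, so the padding is never empty and even the empty word acquires a long
  product.\<close>

definition padding :: "'a list \<Rightarrow> 'a list" where
  "padding w = replicate (n - length w mod (n - 1)) base"

text \<open>A class of the covering group is encoded by the residue of the word length together with
  the value of the word padded by \<open>base\<close>, so no quotient is needed and the order can be read off.\<close>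

definition cls :: "'a list \<Rightarrow> nat \<times> 'a" where
  "cls w = (length w mod (n - 1), long_op (w @ padding w))"

lemma padding_simps: "set (padding w) \<subseteq> G" "padding w \<noteq> []"
proof -
  have "length w mod (n - 1) < n - 1" using arity by (intro mod_less_divisor) auto
  then show "set (padding w) \<subseteq> G" "padding w \<noteq> []" by (auto simp: padding_def)
qed

lemma good_padding: "set w \<subseteq> G \<Longrightarrow> good (w @ padding w)"
proof -
  assume w: "set w \<subseteq> G"
  let ?r = "length w mod (n - 1)"
  have "?r < n - 1" using arity by (intro mod_less_divisor) auto
  then have "length (w @ padding w) = length w - ?r + n" by (simp add: padding_def)
  also have "length w - ?r = (length w div (n - 1)) * (n - 1)" by (simp add: minus_mod_eq_div_mult)
  also have "length w div (n - 1) * (n - 1) + n = (length w div (n - 1) + 1) * (n - 1) + 1"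
    using arity by (simp only: add_mult_distrib mult_1)
  finally show ?thesis by (rule goodI) (use w padding_simps in auto)
qed

lemma cls_in: "set w \<subseteq> G \<Longrightarrow> cls w \<in> {..<n - 1} \<times> G"
  using long_op_closed[OF good_padding] arity by (auto simp: cls_def)

text \<open>A word of length \<open>r + (n - 1)\<close> has residue \<open>r\<close> and is nonempty
  also for \<open>r = 0\<close>; its first letter is left free to reach the value
  \<open>y\<close>.\<close>

lemma cls_surj:
  assumes "c \<in> {..<n - 1} \<times> G"
  obtains w where "set w \<subseteq> G" "cls w = c"
proof -
  obtain r y where c: "c = (r, y)" "r < n - 1" "y \<in> G" using assms by auto
  let ?a = "replicate (n - 1) base"
  \<comment> \<open>After padding, the word is \<open>t\<close> followed by
    \<open>2 * (n - 1)\<close> copies of \<open>base\<close>, so the first letter is found by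
    solving twice.\<close>
  obtain s where s: "s \<in> G" "f ([] @ s # ?a) = y"
    by (rule solve_f[OF c(3), of "[]" ?a]) auto
  obtain t where t: "t \<in> G" "f ([] @ t # ?a) = s"
    by (rule solve_f[OF s(1), of "[]" ?a]) auto
  define w where "w = t # replicate (r + (n - 2)) base"
  have "length w = r + (n - 1)" using arity by (simp add: w_def)
  then have lw: "length w mod (n - 1) = r" using c(2) by (simp only: mod_add_self2 mod_less)
  have "padding w = replicate (n - r) base" by (simp only: padding_def lw)
  then have "w @ padding w = t # replicate (r + (n - 2) + (n - r)) base"
    by (simp only: w_def append_Cons replicate_add)
  also have "r + (n - 2) + (n - r) = (n - 1) + (n - 1)" using c arity by simp
  also have "t # replicate ((n - 1) + (n - 1)) base = [] @ (t # ?a) @ ?a"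
    by (simp only: replicate_add append_Cons append_Nil)
  finally have "w @ padding w = [] @ (t # ?a) @ ?a" .
  then have "long_op (w @ padding w) = long_op ([] @ [f (t # ?a)] @ ?a)"
    using t arity by (simp only:) (intro long_op_reduce goodI[where k = 2]; auto)
  also have "\<dots> = y" using t s arity by (simp add: long_op_basic)
  finally have "cls w = c" using lw c by (simp add: cls_def)
  moreover have "set w \<subseteq> G" using t by (auto simp: w_def)
  ultimately show ?thesis using that by blast
qed

text \<open>The class records the product in one context only, that of the padding. A right inverse
  \<open>b\<close> of the padding reaches the others: inserting \<open>padding w @ b\<close> after
  the word changes nothing, and the word with its padding collapses to the recorded value.\<close>

lemma long_op_cls_cong:
  assumes w: "set w \<subseteq> G" "set w' \<subseteq> G" and eq: "cls w = cls w'"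
    and uv: "u @ v \<noteq> []" "good (u @ w @ v)"
  shows "long_op (u @ w @ v) = long_op (u @ w' @ v)"
proof -
  have l: "length w mod (n - 1) = length w' mod (n - 1)" using eq by (simp add: cls_def)
  then have pad: "padding w' = padding w" by (simp add: padding_def)
  obtain b where b: "set b \<subseteq> G" "(n - 1) dvd length (padding w @ b)"
    "\<And>u v. good (u @ v) \<Longrightarrow> long_op (u @ (padding w @ b) @ v) = long_op (u @ v)"
    using right_inverse_word[OF padding_simps(1)] by blast
  \<comment> \<open>Nonemptiness of \<open>u @ v\<close> keeps the context good even if
    \<open>w'\<close> is the empty word.\<close>
  have uv': "good (u @ w' @ v)"
    using uv w l mod_add_cong[OF l refl, of "length u + length v"] unfolding good_def by (auto simp: add_ac)
  have expand: "long_op (u @ x @ v) = long_op (u @ [long_op (x @ padding w)] @ b @ v)"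
    if x: "good (u @ x @ v)" "good (x @ padding w)" for x
  proof -
    obtain k where k: "length (padding w @ b) = k * (n - 1)" using b(2) by (metis dvdE mult.commute)
    have "length (u @ (x @ padding w) @ b @ v) = length (u @ x @ v) + k * (n - 1)"
      using k by simp
    then have g: "good (u @ (x @ padding w) @ b @ v)"
      by (rule good_extend[OF x(1)]) (use x(1) b(1) padding_simps[of w] in \<open>auto simp: good_def\<close>)
    have "long_op (u @ x @ v) = long_op ((u @ x) @ (padding w @ b) @ v)"
      using b(3)[of "u @ x" v] x(1) by simp
    also have "\<dots> = long_op (u @ (x @ padding w) @ b @ v)" by simp
    also have "\<dots> = long_op (u @ [long_op (x @ padding w)] @ b @ v)"
      by (rule long_op_assoc[OF x(2) g])
    finally show ?thesis .
  qed
  have "long_op (w @ padding w) = long_op (w' @ padding w)" using eq pad by (simp add: cls_def)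
  then show ?thesis
    using expand[OF uv(2) good_padding[OF w(1)]] expand[OF uv'] good_padding[OF w(2)] pad by simp
qed

text \<open>The padding of the whole word supplies the nonempty context for
  \<open>long_op_cls_cong\<close>.\<close>

lemma cls_cong:
  assumes w: "set w \<subseteq> G" "set w' \<subseteq> G" and eq: "cls w = cls w'" and uv: "set u \<subseteq> G" "set v \<subseteq> G"
  shows "cls (u @ w @ v) = cls (u @ w' @ v)"
proof -
  have "length w mod (n - 1) = length w' mod (n - 1)" using eq by (simp add: cls_def)
  from mod_add_cong[OF this refl, of "length u + length v"]
  have l: "length (u @ w @ v) mod (n - 1) = length (u @ w' @ v) mod (n - 1)" by (simp add: add_ac)
  then have pad: "padding (u @ w' @ v) = padding (u @ w @ v)" by (simp add: padding_def)
  have "long_op (u @ w @ v @ padding (u @ w @ v)) = long_op (u @ w' @ v @ padding (u @ w @ v))"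
    using good_padding[of "u @ w @ v"] w uv padding_simps by (intro long_op_cls_cong[OF w eq]) auto
  then show ?thesis using l pad by (simp add: cls_def)
qed

definition word_of :: "nat \<times> 'a \<Rightarrow> 'a list" where
  "word_of c = (SOME w. set w \<subseteq> G \<and> cls w = c)"

lemma word_of:
  assumes "c \<in> {..<n - 1} \<times> G"
  shows "set (word_of c) \<subseteq> G" "cls (word_of c) = c"
proof -
  have "\<exists>w. set w \<subseteq> G \<and> cls w = c" using cls_surj[OF assms] by blast
  from someI_ex[OF this] show "set (word_of c) \<subseteq> G" "cls (word_of c) = c"
    unfolding word_of_def by auto
qed

definition post_group :: "(nat \<times> 'a) monoid" where
  "post_group = \<lparr>carrier = {..<n - 1} \<times> G, monoid.mult = \<lambda>c d. cls (word_of c @ word_of d), one = cls []\<rparr>"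

lemma carrier_post_group: "carrier post_group = {..<n - 1} \<times> G"
  by (simp add: post_group_def)

lemma cls_closed: "set w \<subseteq> G \<Longrightarrow> cls w \<in> carrier post_group"
  unfolding carrier_post_group by (rule cls_in)

lemma post_group_cases:
  assumes "c \<in> carrier post_group"
  obtains w where "set w \<subseteq> G" "c = cls w"
  using cls_surj assms unfolding carrier_post_group by metis

lemma one_post_group: "\<one>\<^bsub>post_group\<^esub> = cls []"
  by (simp add: post_group_def)

lemma cls_append:
  assumes "set u \<subseteq> G" "set v \<subseteq> G"
  shows "cls u \<otimes>\<^bsub>post_group\<^esub> cls v = cls (u @ v)"
proof -
  note u = word_of[OF cls_in[OF assms(1)]] and v = word_of[OF cls_in[OF assms(2)]]
  have "cls (word_of (cls u) @ word_of (cls v)) = cls (u @ word_of (cls v))"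
    using cls_cong[OF u(1) assms(1) u(2), of "[]" "word_of (cls v)"] v(1) by simp
  also have "\<dots> = cls (u @ v)"
    using cls_cong[OF v(1) assms(2) v(2), of u "[]"] assms by simp
  finally show ?thesis by (simp add: post_group_def)
qed

lemma cls_right_inverse:
  assumes "set w \<subseteq> G"
  obtains b where "set b \<subseteq> G" "cls (w @ b) = cls []"
proof -
  obtain b where b: "set b \<subseteq> G" "(n - 1) dvd length (w @ b)"
    "\<And>u v. good (u @ v) \<Longrightarrow> long_op (u @ (w @ b) @ v) = long_op (u @ v)"
    using right_inverse_word[OF assms] by blast
  have l: "length (w @ b) mod (n - 1) = length ([] :: 'a list) mod (n - 1)" using b(2) by simp
  then have "padding (w @ b) = padding []" by (simp add: padding_def)
  then have "cls (w @ b) = cls []"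
    using b(3)[of "[]" "padding []"] good_padding[of "[]"] l by (simp add: cls_def)
  then show ?thesis using that b(1) by blast
qed

lemma group_post_group: "group post_group"
proof (rule groupI)
  show "\<one>\<^bsub>post_group\<^esub> \<in> carrier post_group" by (simp add: one_post_group cls_closed)
  fix c assume "c \<in> carrier post_group"
  then obtain w where w: "set w \<subseteq> G" "c = cls w" by (rule post_group_cases)
  then show "\<one>\<^bsub>post_group\<^esub> \<otimes>\<^bsub>post_group\<^esub> c = c" by (simp add: one_post_group cls_append)
  \<comment> \<open>\<open>groupI\<close> asks for a left inverse, while words come with right
    inverses. A right inverse \<open>b'\<close> of \<open>b\<close> gives \<open>w\<close>,
    \<open>w @ b @ b'\<close> and \<open>b'\<close> the same class, so \<open>b\<close> inverts
    \<open>w\<close> from the left.\<close>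
  obtain b where b: "set b \<subseteq> G" "cls (w @ b) = cls []" using cls_right_inverse[OF w(1)] .
  obtain b' where b': "set b' \<subseteq> G" "cls (b @ b') = cls []" using cls_right_inverse[OF b(1)] .
  have "cls w = cls (w @ b @ b')"
    using cls_cong[OF _ _ b'(2), of w "[]"] w b b' by simp
  also have "\<dots> = cls b'"
    using cls_cong[OF _ _ b(2), of "[]" b'] w b b' by simp
  finally have "cls b \<otimes>\<^bsub>post_group\<^esub> c = cls b \<otimes>\<^bsub>post_group\<^esub> cls b'" using w by simp
  also have "\<dots> = \<one>\<^bsub>post_group\<^esub>" using b b' by (simp add: cls_append one_post_group)
  finally show "\<exists>y\<in>carrier post_group. y \<otimes>\<^bsub>post_group\<^esub> c = \<one>\<^bsub>post_group\<^esub>"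
    using cls_closed[OF b(1)] by blast
  fix d assume "d \<in> carrier post_group"
  then obtain w' where w': "set w' \<subseteq> G" "d = cls w'" by (rule post_group_cases)
  show "c \<otimes>\<^bsub>post_group\<^esub> d \<in> carrier post_group"
    using w w' by (simp add: cls_append cls_closed)
  fix e assume "e \<in> carrier post_group"
  then obtain w'' where w'': "set w'' \<subseteq> G" "e = cls w''" by (rule post_group_cases)
  show "c \<otimes>\<^bsub>post_group\<^esub> d \<otimes>\<^bsub>post_group\<^esub> e = c \<otimes>\<^bsub>post_group\<^esub> (d \<otimes>\<^bsub>post_group\<^esub> e)"
    using w w' w'' by (simp add: cls_append)
qed

lemma card_post_group: "card (carrier post_group) = (n - 1) * card G"
  by (simp add: carrier_post_group card_cartesian_product)

text \<open>Makes \<open>f\<close> the \<open>n\<close>-fold product of the covering group on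
  classes of letters. Both words have the same residue, hence the same padding, and one reduction
  turns one into the other.\<close>

lemma cls_f:
  assumes xs: "length xs = n" "set xs \<subseteq> G"
  shows "cls [f xs] = cls xs"
proof -
  have l: "length xs mod (n - 1) = length [f xs] mod (n - 1)"
  proof -
    have "length xs = 1 + (n - 1)" using xs arity by simp
    then show ?thesis by (metis One_nat_def length_Cons list.size(3) mod_add_self2)
  qed
  then have pad: "padding [f xs] = padding xs" by (simp only: padding_def)
  have "long_op ([] @ xs @ padding xs) = long_op ([] @ [f xs] @ padding xs)"
    using good_padding[OF xs(2)] xs(1) by (intro long_op_reduce) auto
  then show ?thesis using l pad by (simp add: cls_def)
qed

section \<open>Representations of the covering group\<close>

definition word_prod :: "nat \<Rightarrow> ('a \<Rightarrow> complex mat) \<Rightarrow> 'a list \<Rightarrow> complex mat" where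
  "word_prod m \<Lambda> w = foldr (\<lambda>x A. \<Lambda> x * A) w (1\<^sub>m m)"

lemma word_prod_simps [simp]:
  "word_prod m \<Lambda> [] = 1\<^sub>m m" "word_prod m \<Lambda> (x # w) = \<Lambda> x * word_prod m \<Lambda> w"
  by (simp_all add: word_prod_def)

lemma word_prod_carrier:
  "(\<And>x. x \<in> G \<Longrightarrow> \<Lambda> x \<in> carrier_mat m m) \<Longrightarrow> set w \<subseteq> G \<Longrightarrow> word_prod m \<Lambda> w \<in> carrier_mat m m"
  by (induction w) auto

lemma word_prod_append:
  assumes "\<And>x. x \<in> G \<Longrightarrow> \<Lambda> x \<in> carrier_mat m m" "set u \<subseteq> G" "set v \<subseteq> G"
  shows "word_prod m \<Lambda> (u @ v) = word_prod m \<Lambda> u * word_prod m \<Lambda> v"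
  using assms(2)
proof (induction u)
  case Nil
  then show ?case using word_prod_carrier[of \<Lambda> m v] assms by simp
next
  case (Cons x u)
  then show ?case
    using word_prod_carrier[of \<Lambda> m u] word_prod_carrier[of \<Lambda> m v] assms
    by (simp add: assoc_mult_mat[of _ m m _ m _ m])
qed

lemma is_representationD:
  assumes "is_representation n G f m \<Lambda>"
  shows "m \<ge> 1" "x \<in> G \<Longrightarrow> \<Lambda> x \<in> carrier_mat m m" "x \<in> G \<Longrightarrow> invertible_mat (\<Lambda> x)"
    "length xs = n \<Longrightarrow> set xs \<subseteq> G \<Longrightarrow> \<Lambda> (f xs) = word_prod m \<Lambda> xs"
  using assms unfolding is_representation_def general_linear_def word_prod_def by auto

lemma word_prod_iterate_op:
  assumes \<Lambda>: "is_representation n G f m \<Lambda>"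
  shows "length xs = k * (n - 1) + 1 \<Longrightarrow> set xs \<subseteq> G \<Longrightarrow> word_prod m \<Lambda> xs = \<Lambda> (iterate_op k xs)"
proof (induction k arbitrary: xs)
  case 0
  then obtain x where "xs = [x]" by (cases xs) auto
  then show ?case using 0 is_representationD(2)[OF \<Lambda>, of x] by simp
next
  case (Suc k)
  note D = is_representationD[OF \<Lambda>]
  have t: "length (take n xs) = n" "set (take n xs) \<subseteq> G" and d: "set (drop n xs) \<subseteq> G"
    using Suc.prems arity by (auto dest!: in_set_takeD in_set_dropD)
  have "word_prod m \<Lambda> xs = word_prod m \<Lambda> (take n xs @ drop n xs)" by simp
  also have "\<dots> = word_prod m \<Lambda> (take n xs) * word_prod m \<Lambda> (drop n xs)"
    using D(2) t d by (intro word_prod_append) auto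
  also have "\<dots> = word_prod m \<Lambda> (f (take n xs) # drop n xs)" using D(4)[OF t] by simp
  also have "\<dots> = \<Lambda> (iterate_op k (f (take n xs) # drop n xs))"
    using Suc.prems t d arity closed[OF t] by (intro Suc.IH) auto
  finally show ?case by simp
qed

lemma word_prod_long_op:
  assumes "is_representation n G f m \<Lambda>" "good xs"
  shows "word_prod m \<Lambda> xs = \<Lambda> (long_op xs)"
  using word_prod_iterate_op[OF assms(1)] goodD[OF assms(2)] long_op_eq by metis

text \<open>Inverses of the letters are multiplied in reverse order. The result cancels the padding
  in \<open>word_prod_cls_cong\<close>.\<close>

lemma word_prod_invertible:
  assumes \<Lambda>: "is_representation n G f m \<Lambda>" and w: "set w \<subseteq> G"
  obtains B where "B \<in> carrier_mat m m" "word_prod m \<Lambda> w * B = 1\<^sub>m m"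
proof -
  note D = is_representationD[OF \<Lambda>]
  have "\<exists>B\<in>carrier_mat m m. word_prod m \<Lambda> w * B = 1\<^sub>m m"
    using w
  proof (induction w)
    case Nil
    then show ?case by (intro bexI[of _ "1\<^sub>m m"]) auto
  next
    case (Cons x w)
    then obtain B where B: "B \<in> carrier_mat m m" "word_prod m \<Lambda> w * B = 1\<^sub>m m" by auto
    have x: "\<Lambda> x \<in> carrier_mat m m" using D(2) Cons.prems by simp
    have wc: "word_prod m \<Lambda> w \<in> carrier_mat m m" using D(2) Cons.prems by (intro word_prod_carrier) auto
    obtain C where C: "\<Lambda> x * C = 1\<^sub>m m" "C * \<Lambda> x = 1\<^sub>m (dim_row C)"
      using D(3)[of x] x Cons.prems unfolding invertible_mat_def inverts_mat_def by auto
    \<comment> \<open>The dimensions of \<open>C\<close> are read off from its two products with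
      \<open>\<Lambda> x\<close>.\<close>
    have Cc: "C \<in> carrier_mat m m"
      using arg_cong[OF C(1), of dim_col] arg_cong[OF C(2), of dim_col] x by auto
    have "\<Lambda> x * word_prod m \<Lambda> w * (B * C) = \<Lambda> x * (word_prod m \<Lambda> w * B) * C"
      using x wc B(1) Cc by (simp add: assoc_mult_mat[of _ m m _ m _ m])
    then have "word_prod m \<Lambda> (x # w) * (B * C) = 1\<^sub>m m" using B(2) C(1) x by simp
    then show ?case using B Cc by (intro bexI[of _ "B * C"]) auto
  qed
  then show ?thesis using that by blast
qed

text \<open>The class determines the padding and the matrix of the padded word; cancelling the
  invertible matrix of the padding leaves that of the word. This makes \<open>extension\<close>
  independent of representatives.\<close>

lemma word_prod_cls_cong:
  assumes \<Lambda>: "is_representation n G f m \<Lambda>" and w: "set w \<subseteq> G" "set w' \<subseteq> G" and eq: "cls w = cls w'"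
  shows "word_prod m \<Lambda> w = word_prod m \<Lambda> w'"
proof -
  note c = is_representationD(2)[OF \<Lambda>]
  have l: "length w mod (n - 1) = length w' mod (n - 1)"
    and lo: "long_op (w @ padding w) = long_op (w' @ padding w')"
    using eq unfolding cls_def by (simp_all only: prod.inject)
  from l have pad: "padding w' = padding w" by (simp add: padding_def)
  obtain B where B: "B \<in> carrier_mat m m" "word_prod m \<Lambda> (padding w) * B = 1\<^sub>m m"
    using word_prod_invertible[OF \<Lambda> padding_simps(1)] by blast
  let ?p = "word_prod m \<Lambda> (padding w)"
  have p: "?p \<in> carrier_mat m m" using word_prod_carrier[OF c padding_simps(1)] by simp
  have *: "word_prod m \<Lambda> x = \<Lambda> (long_op (x @ padding w)) * B"
    if x: "set x \<subseteq> G" "good (x @ padding w)" for x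
  proof -
    have xc: "word_prod m \<Lambda> x \<in> carrier_mat m m" using word_prod_carrier[OF c x(1)] by simp
    have "\<Lambda> (long_op (x @ padding w)) = word_prod m \<Lambda> (x @ padding w)"
      by (rule word_prod_long_op[OF \<Lambda> x(2), symmetric])
    also have "\<dots> = word_prod m \<Lambda> x * ?p" using word_prod_append[OF c x(1) padding_simps(1)] by simp
    finally have "\<Lambda> (long_op (x @ padding w)) * B = word_prod m \<Lambda> x * (?p * B)"
      using xc p B(1) by (simp add: assoc_mult_mat[of _ m m _ m _ m])
    then show ?thesis using B(2) xc by simp
  qed
  from *[OF w(1) good_padding[OF w(1)]] *[OF w(2)] good_padding[OF w(2)] pad lo
  show ?thesis by simp
qed

definition extension :: "nat \<Rightarrow> ('a \<Rightarrow> complex mat) \<Rightarrow> nat \<times> 'a \<Rightarrow> complex mat" where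
  "extension m \<Lambda> c = word_prod m \<Lambda> (word_of c)"

lemma extension_cls:
  assumes "is_representation n G f m \<Lambda>" "set w \<subseteq> G"
  shows "extension m \<Lambda> (cls w) = word_prod m \<Lambda> w"
  unfolding extension_def
  using word_prod_cls_cong[OF assms(1)] word_of[OF cls_in[OF assms(2)]] assms(2) by blast

lemma group_rep_extension:
  assumes \<Lambda>: "is_representation n G f m \<Lambda>"
  shows "group_rep post_group m (extension m \<Lambda>)"
  unfolding group_rep_def
proof (intro conjI ballI)
  note c = is_representationD(2)[OF \<Lambda>]
  show "extension m \<Lambda> \<one>\<^bsub>post_group\<^esub> = 1\<^sub>m m"
    by (simp add: one_post_group extension_cls[OF \<Lambda>])
  fix x assume "x \<in> carrier post_group"
  then obtain w where w: "set w \<subseteq> G" "x = cls w" by (rule post_group_cases)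
  then show "extension m \<Lambda> x \<in> carrier_mat m m"
    using word_prod_carrier[OF c] by (simp add: extension_cls[OF \<Lambda>])
  fix y assume "y \<in> carrier post_group"
  then obtain w' where w': "set w' \<subseteq> G" "y = cls w'" by (rule post_group_cases)
  show "extension m \<Lambda> (x \<otimes>\<^bsub>post_group\<^esub> y) = extension m \<Lambda> x * extension m \<Lambda> y"
    using w w' word_prod_append[OF c w(1) w'(1)] by (simp add: cls_append extension_cls[OF \<Lambda>])
qed

text \<open>The classes of single letters carry the matrices \<open>\<Lambda> x\<close>, so a
  subspace invariant under the covering group is invariant under \<open>G\<close>.\<close>

lemma irreducible_extension:
  assumes "is_irreducible_representation n G f m \<Lambda>"
  shows "irreducible_on (carrier post_group) m (extension m \<Lambda>)"
proof -
  have \<Lambda>: "is_representation n G f m \<Lambda>" using assms by (simp add: is_irreducible_representation_def)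
  have ext: "extension m \<Lambda> (cls [x]) = \<Lambda> x" if "x \<in> G" for x
    using extension_cls[OF \<Lambda>, of "[x]"] is_representationD(2)[OF \<Lambda> that] that by simp
  show ?thesis
    unfolding irreducible_on_def
  proof (intro conjI allI impI ballI)
    show "m \<ge> 1" by (rule is_representationD(1)[OF \<Lambda>])
    show "extension m \<Lambda> c \<in> carrier_mat m m" if "c \<in> carrier post_group" for c
      by (rule group_repD(1)[OF group_rep_extension[OF \<Lambda>] that])
    fix W assume W: "VectorSpace.subspace class_ring W (module_vec TYPE(complex) m) \<and>
      (\<forall>c\<in>carrier post_group. \<forall>w\<in>W. extension m \<Lambda> c *\<^sub>v w \<in> W)"
    have "\<Lambda> x *\<^sub>v w \<in> W" if "x \<in> G" "w \<in> W" for x w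
      using bspec[OF conjunct2[OF W] cls_closed[of "[x]"]] that ext[OF that(1)] by simp
    then show "W = {0\<^sub>v m} \<or> W = carrier_vec m"
      using assms W unfolding is_irreducible_representation_def by simp
  qed
qed

section \<open>Restricting representations to single letters\<close>

text \<open>Every class is a product of classes of letters, so a representation of the covering
  group is determined by its values there.\<close>

lemma group_rep_cls:
  assumes \<rho>: "group_rep post_group m \<rho>" and w: "set w \<subseteq> G"
  shows "\<rho> (cls w) = word_prod m (\<lambda>x. \<rho> (cls [x])) w"
  using w
proof (induction w)
  case Nil
  then show ?case using group_repD(2)[OF \<rho>] by (simp add: one_post_group)
next
  case (Cons x w)
  have "\<rho> (cls (x # w)) = \<rho> (cls [x] \<otimes>\<^bsub>post_group\<^esub> cls w)"
    using Cons.prems by (simp add: cls_append)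
  also have "\<dots> = \<rho> (cls [x]) * \<rho> (cls w)"
    using Cons.prems by (intro group_repD(3)[OF \<rho>] cls_closed) auto
  finally show ?case using Cons by simp
qed

lemma restriction_representation:
  assumes \<rho>: "group_rep post_group m \<rho>" and m: "m \<ge> 1"
  shows "is_representation n G f m (\<lambda>x. \<rho> (cls [x]))"
  unfolding is_representation_def
proof (intro conjI ballI allI impI)
  interpret group post_group by (rule group_post_group)
  fix x assume "x \<in> G"
  then have c: "cls [x] \<in> carrier post_group" by (intro cls_closed) simp
  note car = group_repD(1)[OF \<rho>]
  have "\<rho> (cls [x]) * \<rho> (inv\<^bsub>post_group\<^esub> cls [x]) = 1\<^sub>m m"
    "\<rho> (inv\<^bsub>post_group\<^esub> cls [x]) * \<rho> (cls [x]) = 1\<^sub>m m"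
    using c by (simp_all add: group_repD(2)[OF \<rho>] flip: group_repD(3)[OF \<rho>])
  then show "\<rho> (cls [x]) \<in> general_linear m"
    using car[OF c] car[OF inv_closed[OF c]]
    unfolding general_linear_def invertible_mat_def inverts_mat_def by auto
next
  fix xs assume xs: "length xs = n \<and> set xs \<subseteq> G"
  show "\<rho> (cls [f xs]) = foldr (\<lambda>x. (*) (\<rho> (cls [x]))) xs (1\<^sub>m m)"
    using group_rep_cls[OF \<rho>, of xs] cls_f[of xs] xs by (simp add: word_prod_def)
qed (rule m)

text \<open>Invariance under the letters passes to their products, hence to the whole covering
  group.\<close>

lemma restriction_irreducible:
  assumes \<rho>: "group_rep post_group m \<rho>" and irr: "irreducible_on (carrier post_group) m \<rho>"
  shows "is_irreducible_representation n G f m (\<lambda>x. \<rho> (cls [x]))"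
  unfolding is_irreducible_representation_def
proof (intro conjI allI impI)
  have "m \<ge> 1" using irr by (simp add: irreducible_on_def)
  then show "is_representation n G f m (\<lambda>x. \<rho> (cls [x]))" by (rule restriction_representation[OF \<rho>])
  fix W assume W: "VectorSpace.subspace class_ring W (module_vec TYPE(complex) m) \<and>
    (\<forall>x\<in>G. \<forall>w\<in>W. \<rho> (cls [x]) *\<^sub>v w \<in> W)"
  have Wc: "w \<in> carrier_vec m" if "w \<in> W" for w using subspace_vecD(1) W that by blast
  have car: "\<rho> (cls [x]) \<in> carrier_mat m m" if "x \<in> G" for x
    using that by (intro group_repD(1)[OF \<rho>] cls_closed) simp
  have inv: "word_prod m (\<lambda>x. \<rho> (cls [x])) u *\<^sub>v w \<in> W" if "set u \<subseteq> G" "w \<in> W" for u w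
    using that
  proof (induction u)
    case Nil
    then show ?case using Wc by simp
  next
    case (Cons x u)
    have "word_prod m (\<lambda>x. \<rho> (cls [x])) (x # u) *\<^sub>v w =
        \<rho> (cls [x]) *\<^sub>v (word_prod m (\<lambda>x. \<rho> (cls [x])) u *\<^sub>v w)"
      using Cons.prems car Wc word_prod_carrier[of "\<lambda>x. \<rho> (cls [x])" m u]
      by (simp add: assoc_mult_mat_vec[of _ m m _ m])
    then show ?case using Cons W by auto
  qed
  show "W = {0\<^sub>v m} \<or> W = carrier_vec m"
  proof (rule irreducible_onD[OF irr])
    fix c w assume "c \<in> carrier post_group" "w \<in> W"
    then show "\<rho> c *\<^sub>v w \<in> W"
      using inv by (elim post_group_cases) (simp add: group_rep_cls[OF \<rho>])
  qed (use W in blast)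
qed

text \<open>Between neighbouring letters the factors \<open>S * T\<close> cancel, so one conjugating
  matrix serves for letters and for words.\<close>

lemma word_prod_conjugate:
  assumes c: "\<And>x. x \<in> G \<Longrightarrow> \<Lambda> x \<in> carrier_mat m m"
    and T: "T \<in> carrier_mat m m" "S \<in> carrier_mat m m" "T * S = 1\<^sub>m m" "S * T = 1\<^sub>m m"
    and eq: "\<And>x. x \<in> G \<Longrightarrow> \<Lambda>' x = T * \<Lambda> x * S" and w: "set w \<subseteq> G"
  shows "word_prod m \<Lambda>' w = T * word_prod m \<Lambda> w * S"
  using w
proof (induction w)
  case Nil
  then show ?case using T by simp
next
  case (Cons x w)
  have x: "\<Lambda> x \<in> carrier_mat m m" using c Cons.prems by simp
  have wc: "word_prod m \<Lambda> w \<in> carrier_mat m m" using c Cons.prems by (intro word_prod_carrier) auto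
  have "word_prod m \<Lambda>' (x # w) = (T * \<Lambda> x * S) * (T * word_prod m \<Lambda> w * S)"
    using Cons eq by simp
  also have "\<dots> = T * \<Lambda> x * (S * T) * (word_prod m \<Lambda> w * S)"
    using T(1,2) x wc by (simp add: assoc_mult_mat[of _ m m _ m _ m])
  also have "\<dots> = T * (\<Lambda> x * word_prod m \<Lambda> w) * S"
    using T x wc by (simp add: assoc_mult_mat[of _ m m _ m _ m])
  finally show ?case by simp
qed

lemma equivalent_extension:
  assumes \<Lambda>: "is_representation n G f m \<Lambda>" and \<rho>: "group_rep post_group m \<rho>"
    and eq: "equivalent_representations G m \<Lambda> (\<lambda>x. \<rho> (cls [x]))"
  shows "equivalent_representations (carrier post_group) m (extension m \<Lambda>) \<rho>"
proof -
  obtain T S where T: "T \<in> general_linear m" "S \<in> carrier_mat m m" "T * S = 1\<^sub>m m" "S * T = 1\<^sub>m m"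
    and "\<forall>x\<in>G. \<rho> (cls [x]) = T * \<Lambda> x * S"
    using eq unfolding equivalent_representations_def by blast
  moreover have "\<rho> c = T * extension m \<Lambda> c * S" if c: "c \<in> carrier post_group" for c
  proof -
    obtain w where w: "set w \<subseteq> G" "c = cls w" using c by (rule post_group_cases)
    have "word_prod m (\<lambda>x. \<rho> (cls [x])) w = T * word_prod m \<Lambda> w * S"
      using calculation is_representationD(2)[OF \<Lambda>] w
      by (intro word_prod_conjugate) (auto simp: general_linear_def)
    then show ?thesis using w by (simp add: group_rep_cls[OF \<rho>] extension_cls[OF \<Lambda>])
  qed
  ultimately show ?thesis unfolding equivalent_representations_def by blast
qed

lemma equivalent_restriction:
  assumes \<Lambda>: "is_representation n G f m \<Lambda>" and \<Lambda>': "is_representation n G f m \<Lambda>'"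
    and eq: "equivalent_representations (carrier post_group) m (extension m \<Lambda>) (extension m \<Lambda>')"
  shows "equivalent_representations G m \<Lambda> \<Lambda>'"
proof -
  have ext: "extension m \<Lambda> (cls [x]) = \<Lambda> x" "extension m \<Lambda>' (cls [x]) = \<Lambda>' x"
    and "cls [x] \<in> carrier post_group" if "x \<in> G" for x
    using extension_cls[OF \<Lambda>, of "[x]"] is_representationD(2)[OF \<Lambda> that]
      extension_cls[OF \<Lambda>', of "[x]"] is_representationD(2)[OF \<Lambda>' that] that cls_closed[of "[x]"] by auto
  then show ?thesis using eq unfolding equivalent_representations_def by metis
qed

end

section \<open>From the covering group back to the polyadic group\<close>

theorem theorem3p1:
  fixes n :: nat and G :: "'a set" and f :: "'a list \<Rightarrow> 'a"
    and k :: nat and d :: "nat \<Rightarrow> nat" and \<Lambda> :: "nat \<Rightarrow> 'a \<Rightarrow> complex mat"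
  assumes "nary_group n G f"
    and "finite G"
    and irreducible: "\<And>i. i \<in> {1..k} \<Longrightarrow> is_irreducible_representation n G f (d i) (\<Lambda> i)"
    and non_equivalent: "\<And>i j. i \<in> {1..k} \<Longrightarrow> j \<in> {1..k} \<Longrightarrow> i \<noteq> j \<Longrightarrow>
        \<not> (d i = d j \<and> equivalent_representations G (d i) (\<Lambda> i) (\<Lambda> j))"
    and exhaustive: "\<And>m \<rho>. is_irreducible_representation n G f m \<rho> \<Longrightarrow>
        \<exists>i\<in>{1..k}. d i = m \<and> equivalent_representations G m (\<Lambda> i) \<rho>"
  shows "(\<forall>i\<in>{1..k}. d i dvd (n - 1) * card G) \<and>
    (\<Sum>i=1..k. (d i)\<^sup>2) = (n - 1) * card G"
proof -
  interpret nary_group n G f by fact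
  interpret P: finite_group post_group
    by (intro finite_group.intro finite_group_axioms.intro group_post_group)
      (simp add: carrier_post_group \<open>finite G\<close>)
  let ?E = "\<lambda>i. extension (d i) (\<Lambda> i)"
  have \<Lambda>: "is_representation n G f (d i) (\<Lambda> i)" if "i \<in> {1..k}" for i
    using irreducible[OF that] by (simp add: is_irreducible_representation_def)
  have rep: "group_rep post_group (d i) (?E i)" if "i \<in> {1..k}" for i
    by (rule group_rep_extension[OF \<Lambda>[OF that]])
  have irr: "irreducible_on (carrier post_group) (d i) (?E i)" if "i \<in> {1..k}" for i
    by (rule irreducible_extension[OF irreducible[OF that]])
  have "(\<Sum>i=1..k. (d i)\<^sup>2) = card (carrier post_group)"
  proof (rule P.sum_of_squares_of_degrees[OF _ rep irr])
    show "\<not> (d i = d j \<and> equivalent_representations (carrier post_group) (d i) (?E i) (?E j))"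
      if ij: "i \<in> {1..k}" "j \<in> {1..k}" "i \<noteq> j" for i j
      using non_equivalent[OF ij] equivalent_restriction[OF \<Lambda>[OF ij(1)], of "\<Lambda> j"] \<Lambda>[OF ij(2)] by metis
    \<comment> \<open>An irreducible representation of the covering group is restricted to letters,
      matched with some \<open>\<Lambda> i\<close> by \<open>exhaustive\<close>, and the equivalence
      is carried back to all words.\<close>
    show "\<exists>i\<in>{1..k}. d i = m \<and> equivalent_representations (carrier post_group) m (?E i) \<rho>"
      if \<rho>: "group_rep post_group m \<rho>" "irreducible_on (carrier post_group) m \<rho>" for m \<rho>
    proof -
      obtain i where i: "i \<in> {1..k}" "d i = m" "equivalent_representations G m (\<Lambda> i) (\<lambda>x. \<rho> (cls [x]))"
        using exhaustive[OF restriction_irreducible[OF \<rho>]] by blast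
      then show ?thesis using equivalent_extension[OF _ \<rho>(1)] \<Lambda>[OF i(1)] by blast
    qed
  qed auto
  then show ?thesis
    using P.degree_dvd_order[OF rep irr] by (simp add: card_post_group)
qed

end
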